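(* Let $\mathbf{F}$ be a finite field with $q$ elements, $V=\mathbf{F}^n$, and $k$ a field in which $q$ is nonzero. For each subspace $W\subseteq V$ define \[ \eta_W = q^{-\dim W\cdot \dim(V/W)}\,\mu(\dim W)^{-1}\sum_{\substack{T\colon V\to V \text{ semi-idempotent}\\ \operatorname{im} T\subseteq W}} \mu(\mathrm{srk}\, T)\,[T]\in k[\mathfrak{M}_n]. \] Then the elements $\eta_W$ (as $W$ ranges over all subspaces of $V$) are pairwise orthogonal idempotents of $k[\mathfrak{M}_n]$ (i.e. $\eta_W^2=\eta_W$ and $\eta_{W_1}\eta_{W_2}=0$ for $W_1\ne W_2$). Moreover, for $0\le r\le n-1$, \[ \eta_r=\sum_{\dim W\le r}\eta_W, \] where $\eta_r = q^{-(n-1)r}\mu(r)\sum_m \mu(\mathrm{srk}\, m)\binom{n-1-\operatorname{rank} m}{r-\operatorname{rank} m}_q [m]$ (sum over semi-idempotent $m\in\mathfrak{M}_n$ of rank $\le r$). Finally, $\psi_r(\eta_W)=[\mathrm{id}_W]$ if $\dim W=r$, and $\psi_r(\eta_W)=0$ if $\dim W<r$.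
   Context: $\mathfrak{M}_n$ is the monoid of $n\times n$ matrices over $\mathbf{F}$ (identified with $\operatorname{End}_{\mathbf{F}}(V)$), $k[\mathfrak{M}_n]$ its monoid algebra with basis $[m]$. A linear operator $T$ on $V$ is semi-idempotent if $V=X\oplus Y$ with $X,Y$ $T$-stable, $T|_X=\mathrm{id}$, $T|_Y$ nilpotent. $\mathrm{srk}\,T$ is the rank of $T^i$ for $i\gg0$. $\mu(i)=(-1)^iq^{\binom i2}$; $\binom{a}{b}_q$ is the $q$-binomial coefficient. $\mathcal{G}_{n,r}$ is the groupoid whose objects are the $r$-dimensional subspaces of $\mathbf{F}^n$ and whose morphisms are linear isomorphisms; its groupoid algebra $k[\mathcal{G}_{n,r}]$ has basis $[a]$ for isomorphisms $a$, with $[b][a]=[b\circ a]$ if composable and $0$ otherwise. The linear map $\psi_r\colon k[\mathfrak{M}_n]\to k[\mathcal{G}_{n,r}]$ is $\psi_r([m])=\sum_U [m|_U]$, summing over $r$-dimensional subspaces $U$ with $\dim m(U)=r$, where $m|_U$ is regarded as an isomorphism $U\to m(U)$. *)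

theory Defs
  imports "HOL-Analysis.Analysis"
begin

text \<open>Setting: \<open>F\<close> is a finite field (type \<open>'f\<close>), \<open>q = CARD('f)\<close>;
 \<open>V = 'f^'n\<close> with \<open>n = CARD('n)\<close>; \<open>\<M>_n\<close> is the monoid of matrices \<open>'f^'n^'n\<close>
 acting on \<open>V\<close> by \<open>*v\<close>, with product \<open>**\<close> (= composition).
 The monoid algebra \<open>k[\<M>_n]\<close> is the space of functions \<open>'f^'n^'n \<Rightarrow> 'k\<close>
 (every function is finitely supported since the monoid is finite),
 with convolution product; \<open>[m]\<close> is the indicator function of \<open>m\<close>.\<close>

definition mbasis :: "'a \<Rightarrow> 'a \<Rightarrow> 'k::field" where
  "mbasis m = (\<lambda>x. if x = m then 1 else 0)"

definition alg_mult ::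
  "('f::{finite,field}^'n^'n \<Rightarrow> 'k::field) \<Rightarrow> ('f^'n^'n \<Rightarrow> 'k) \<Rightarrow> ('f^'n^'n \<Rightarrow> 'k)" where
  "alg_mult a b = (\<lambda>m. \<Sum>p\<in>{(m1, m2). m1 ** m2 = m}. a (fst p) * b (snd p))"

definition mat_rank :: "'f::{finite,field}^'n^'n \<Rightarrow> nat" where
  "mat_rank T = vec.dim (range (\<lambda>x. T *v x))"

definition semi_idempotent :: "'f::{finite,field}^'n^'n \<Rightarrow> bool" where
  "semi_idempotent T \<longleftrightarrow> (\<exists>X Y. vec.subspace X \<and> vec.subspace Y \<and> X \<inter> Y = {0}
      \<and> (\<forall>v. \<exists>x\<in>X. \<exists>y\<in>Y. v = x + y)
      \<and> (\<forall>x\<in>X. T *v x \<in> X) \<and> (\<forall>y\<in>Y. T *v y \<in> Y)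
      \<and> (\<forall>x\<in>X. T *v x = x)
      \<and> (\<exists>N. \<forall>y\<in>Y. ((\<lambda>v. T *v v) ^^ N) y = 0))"

definition srk :: "'f::{finite,field}^'n^'n \<Rightarrow> nat" where
  "srk T = (THE r. \<exists>N. \<forall>i\<ge>N. vec.dim (range ((\<lambda>v. T *v v) ^^ i)) = r)"

definition mu :: "nat \<Rightarrow> nat \<Rightarrow> 'k::field" where
  "mu q i = (-1) ^ i * of_nat q ^ (i choose 2)"

text \<open>Gaussian binomial coefficient, via the q-Pascal recursion (a polynomial in q with
  integer coefficients, evaluated at the natural number q).\<close>
fun qbinom :: "nat \<Rightarrow> nat \<Rightarrow> nat \<Rightarrow> nat" where
  "qbinom q 0 0 = 1"
| "qbinom q 0 (Suc b) = 0"
| "qbinom q (Suc a) 0 = 1"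
| "qbinom q (Suc a) (Suc b) = qbinom q a b + q ^ Suc b * qbinom q a (Suc b)"

definition eta_W :: "('f::{finite,field}^'n) set \<Rightarrow> ('f^'n^'n \<Rightarrow> 'k::field)" where
  "eta_W W = (\<lambda>T. if semi_idempotent T \<and> range (\<lambda>x. T *v x) \<subseteq> W
      then inverse (of_nat CARD('f) ^ (vec.dim W * (CARD('n) - vec.dim W)))
           * inverse (mu CARD('f) (vec.dim W)) * mu CARD('f) (srk T)
      else 0)"

definition eta_r :: "nat \<Rightarrow> ('f::{finite,field}^'n^'n \<Rightarrow> 'k::field)" where
  "eta_r r = (\<lambda>m. if semi_idempotent m \<and> mat_rank m \<le> r
      then inverse (of_nat CARD('f) ^ ((CARD('n) - 1) * r)) * mu CARD('f) r * mu CARD('f) (srk m)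
           * of_nat (qbinom CARD('f) (CARD('n) - 1 - mat_rank m) (r - mat_rank m))
      else 0)"

text \<open>Morphisms of the groupoid \<open>\<G>_{n,r}\<close>: triples (source, target, map), the map being
 normalised to \<open>0\<close> outside the source. Elements of \<open>k[\<G>_{n,r}]\<close> are functions from
 such triples to \<open>k\<close> (supported on isomorphisms between r-dimensional subspaces).\<close>

type_synonym ('f,'n) gmor = "('f^'n) set \<times> ('f^'n) set \<times> ('f^'n \<Rightarrow> 'f^'n)"

definition restr_mor :: "'f::{finite,field}^'n^'n \<Rightarrow> ('f^'n) set \<Rightarrow> ('f,'n) gmor" where
  "restr_mor m U = (U, (\<lambda>x. m *v x) ` U, (\<lambda>x. if x \<in> U then m *v x else 0))"

definition id_mor :: "('f::{finite,field}^'n) set \<Rightarrow> ('f,'n) gmor" where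
  "id_mor W = (W, W, (\<lambda>x. if x \<in> W then x else 0))"

definition psi :: "nat \<Rightarrow> ('f::{finite,field}^'n^'n \<Rightarrow> 'k::field) \<Rightarrow> (('f,'n) gmor \<Rightarrow> 'k)" where
  "psi r a = (\<lambda>g. \<Sum>m\<in>UNIV. a m *
      (\<Sum>U\<in>{U. vec.subspace U \<and> vec.dim U = r \<and> vec.dim ((\<lambda>x. m *v x) ` U) = r}.
         mbasis (restr_mor m U) g))"

end

theory Submission
  imports Defs
begin

text \<open>
  Write \<open>\<chi> T = \<mu> (srk T)\<close> if \<open>T\<close> is semi-idempotent and \<open>\<chi> T = 0\<close> otherwise. Since \<open>T\<close> is
  semi-idempotent iff its powers are eventually constant, \<open>\<chi> (A B) = \<chi> (B A)\<close> and \<open>\<chi>\<close> is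
  invariant under transposition. The heart of the matter is that \<open>\<chi>\<close> sums to zero over every coset
  \<open>{M + w \<otimes> p | w \<in> W}\<close>, where \<open>im M \<subseteq> W\<close> and the functional \<open>p\<close> does not vanish on \<open>W\<close>. Hence
  \<open>\<Sum> \<chi> T = 0\<close> over all \<open>T\<close> with image in \<open>W\<close> and prescribed values on a subspace not containing \<open>W\<close>,
  and, transposing, over all \<open>T\<close> with image in \<open>W\<close> and a prescribed product \<open>X T\<close>, where \<open>X\<close> is not
  injective on \<open>W\<close>. In \<open>\<eta>\<^sub>W \<eta>\<^sub>W\<close> and in \<open>\<psi>\<^sub>r (\<eta>\<^sub>W)\<close> only the \<open>q\<^bsup>d(n-d)\<^esup>\<close> projections onto \<open>W\<close> survive.
  The formula for \<open>\<eta>\<^sub>r\<close> reduces, by counting the subspaces that contain \<open>im m\<close>, to an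
  alternating sum of \<open>q\<close>-binomial coefficients that telescopes by the \<open>q\<close>-Pascal rule.
\<close>

subsection \<open>Linear algebra\<close>

definition dotv :: "'f::field^'n \<Rightarrow> 'f^'n \<Rightarrow> 'f" where
  "dotv p x = (\<Sum>j\<in>UNIV. p $ j * x $ j)"

definition outer :: "'f::field^'n \<Rightarrow> 'f^'n \<Rightarrow> 'f^'n^'n" where
  "outer w p = (\<chi> i j. w $ i * p $ j)"

lemma dotv_linear [simp]:
  "dotv p (x + y) = dotv p x + dotv p y"
  "dotv p (x - y) = dotv p x - dotv p y"
  "dotv p (c *s x) = c * dotv p x"
  "dotv p 0 = 0"
  by (simp_all add: dotv_def algebra_simps sum.distrib sum_subtractf sum_distrib_left)

lemma dotv_axis [simp]: "dotv (axis i c) x = c * x $ i"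
  unfolding dotv_def axis_def by (simp add: if_distrib [of "\<lambda>y. y * _"] cong: if_cong)

lemma exists_dotv_eq_1:
  fixes l :: "'f::field^'n"
  assumes "l \<noteq> 0"
  shows "\<exists>p. dotv p l = 1"
proof -
  obtain i where "l $ i \<noteq> 0" using assms by (auto simp: vec_eq_iff)
  then have "dotv (axis i (1 / l $ i)) l = 1" by simp
  then show ?thesis ..
qed

lemma outer_mult_vec [simp]: "outer w p *v x = dotv p x *s w"
  by (simp add: outer_def dotv_def matrix_vector_mult_def vec_eq_iff sum_distrib_left sum_distrib_right mult_ac)

lemma matrix_mult_outer: "A ** outer w p = outer (A *v w) p"
  by (simp add: matrix_eq matrix_vector_mul_assoc [symmetric] vec.scale)

lemma dotv_vector_matrix_mult: "dotv (p v* A) x = dotv p (A *v x)"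
proof -
  have "dotv (p v* A) x = (\<Sum>j\<in>UNIV. \<Sum>i\<in>UNIV. p $ i * (A $ i $ j * x $ j))"
    by (simp add: dotv_def vector_matrix_mult_def sum_distrib_left mult_ac)
  also have "\<dots> = (\<Sum>i\<in>UNIV. \<Sum>j\<in>UNIV. p $ i * (A $ i $ j * x $ j))"
    by (rule sum.swap)
  finally show ?thesis
    by (simp add: dotv_def matrix_vector_mult_def sum_distrib_left mult_ac)
qed

lemma outer_diff_left: "outer (w - w') p = outer w p - outer w' p"
  by (simp add: outer_def vec_eq_iff algebra_simps)

lemma transpose_outer: "transpose (outer w p) = outer p w"
  by (simp add: outer_def transpose_def vec_eq_iff)

lemma transpose_add: "transpose (A + B) = transpose A + transpose B"
  by (simp add: transpose_def vec_eq_iff)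

lemma subspace_kernel_dotv: "vec.subspace W \<Longrightarrow> vec.subspace {x \<in> W. dotv p x = 0}"
  by (auto simp: vec.subspace_def)

text \<open>Extend the inclusion of a basis of \<open>W\<close> to all of \<open>V\<close>, keeping
  the range equal to the span of that basis.\<close>

lemma exists_projection:
  fixes W :: "('f::field^'n) set"
  assumes "vec.subspace W"
  obtains Q :: "'f^'n^'n" where "range ((*v) Q) = W" "\<And>x. x \<in> W \<Longrightarrow> Q *v x = x"
proof -
  obtain B where B: "B \<subseteq> W" "vec.independent B" "vec.span B = W"
    using vec.basis_subspace_exists [OF assms] by metis
  obtain g where g: "Vector_Spaces.linear (*s) (*s) g" "\<forall>x\<in>B. g x = id x" "range g = vec.span (id ` B)"
    using vec.linear_independent_extend_subspace [OF B(2), of id] by blast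
  have "g x = id x" if "x \<in> W" for x
    by (rule vec.linear_eq_on [OF g(1) vec.linear_id]) (use g(2) that B(3) in auto)
  moreover have "(*v) (matrix g) = g" using matrix_works [OF g(1)] by auto
  ultimately show ?thesis using that [of "matrix g"] g B by simp
qed

text \<open>With \<open>Q\<close> a projection onto \<open>R\<close>, take a functional that is 1 on
  \<open>v - Q *v v\<close> and pull it back along \<open>mat 1 - Q\<close>, which kills
  \<open>R\<close>.\<close>

lemma exists_separating_functional:
  fixes R :: "('f::field^'n) set"
  assumes "vec.subspace R" "v \<notin> R"
  obtains p where "dotv p v = 1" "\<And>x. x \<in> R \<Longrightarrow> dotv p x = 0"
proof -
  obtain Q :: "'f^'n^'n" where Q: "range ((*v) Q) = R" "\<And>x. x \<in> R \<Longrightarrow> Q *v x = x"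
    using exists_projection [OF assms(1)] by metis
  have "Q *v v \<in> R" using Q(1) by auto
  then have "v - Q *v v \<noteq> 0" using assms by auto
  then obtain p where p: "dotv p (v - Q *v v) = 1" using exists_dotv_eq_1 by blast
  show ?thesis
  proof
    show "dotv (p - p v* Q) v = 1"
      using p by (simp add: dotv_def [of "_ - _"] left_diff_distrib sum_subtractf dotv_def [symmetric] dotv_vector_matrix_mult)
    show "dotv (p - p v* Q) x = 0" if "x \<in> R" for x
      using Q that by (simp add: dotv_def [of "_ - _"] left_diff_distrib sum_subtractf dotv_def [symmetric] dotv_vector_matrix_mult)
  qed
qed

text \<open>Subtracting the multiple \<open>dotv p x / dotv p w\<close> of \<open>w\<close> moves
  any \<open>x\<close> of \<open>W\<close> into the kernel, so \<open>w\<close> spans a complement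
  of the kernel in \<open>W\<close>.\<close>

lemma dim_kernel_dotv:
  fixes W :: "('f::field^'n) set"
  assumes W: "vec.subspace W" and w: "w \<in> W" "dotv p w \<noteq> 0"
  shows "vec.dim W = Suc (vec.dim {x \<in> W. dotv p x = 0})"
    and "vec.span (insert w {x \<in> W. dotv p x = 0}) = W"
proof -
  let ?K = "{x \<in> W. dotv p x = 0}"
  have K: "vec.subspace ?K" by (rule subspace_kernel_dotv [OF W])
  show *: "vec.span (insert w ?K) = W"
  proof
    show "vec.span (insert w ?K) \<subseteq> W" using w by (intro vec.span_minimal W) auto
    show "W \<subseteq> vec.span (insert w ?K)"
    proof
      fix x assume x: "x \<in> W"
      let ?k = "dotv p x / dotv p w"
      have "x - ?k *s w \<in> ?K" using W x w by (auto intro: vec.subspace_diff vec.subspace_scale)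
      then show "x \<in> vec.span (insert w ?K)"
        unfolding vec.span_breakdown_eq by (blast intro: vec.span_base)
    qed
  qed
  have "w \<notin> vec.span ?K" using w K by (simp add: vec.span_eq_iff [THEN iffD2])
  then show "vec.dim W = Suc (vec.dim ?K)"
    using vec.dim_insert [of w ?K] vec.dim_span [of "insert w ?K"] * by simp
qed

lemma dim_less_of_notin:
  fixes S T :: "('f::field^'n) set"
  assumes "vec.subspace S" "vec.subspace T" "S \<subseteq> T" "x \<in> T" "x \<notin> S"
  shows "vec.dim S < vec.dim T"
  using vec.subspace_dim_equal [OF assms(1-3)] assms(4,5) by (metis not_less)

lemma dim_image_eq_of_trivial_kernel:
  fixes T :: "'f::field^'n^'n"
  assumes W: "vec.subspace W" and inj: "\<And>v. v \<in> W \<Longrightarrow> T *v v = 0 \<Longrightarrow> v = 0"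
  shows "vec.dim ((*v) T ` W) = vec.dim W"
proof (rule vec.dim_image_eq)
  show "inj_on ((*v) T) (vec.span W)"
  proof (rule inj_onI)
    fix x y assume "x \<in> vec.span W" "y \<in> vec.span W" "T *v x = T *v y"
    then have "x - y \<in> W" "T *v (x - y) = 0"
      using W vec.subspace_diff [OF W] vec.span_eq_iff [THEN iffD2, OF W] by (simp_all add: vec.diff)
    then show "x = y" using inj by force
  qed
qed simp

text \<open>Rank factorisation: if a basis \<open>B\<close> of the column space expresses column
  \<open>j\<close> with coefficients \<open>c j b\<close>, every row is a combination of the vectors
  \<open>g b\<close> formed from these coefficients, so \<open>card B\<close> vectors span the
  rows.\<close>

lemma dim_rows_le_dim_columns_gen:
  fixes A :: "'f::field^'n^'m"
  shows "vec.dim (rows A) \<le> vec.dim (columns A)"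
proof -
  obtain B where B: "B \<subseteq> columns A" "vec.independent B" "columns A \<subseteq> vec.span B"
    "card B = vec.dim (columns A)"
    using vec.basis_exists by blast
  have fin: "finite B" using B(2) by (rule vec.finiteI_independent)
  have "\<exists>c. column j A = (\<Sum>b\<in>B. c b *s b)" for j
  proof -
    have "column j A \<in> vec.span B" using B(3) by (auto simp: columns_def)
    then show ?thesis using vec.span_finite [OF fin] by auto
  qed
  then obtain c where c: "\<And>j. column j A = (\<Sum>b\<in>B. c j b *s b)" by metis
  define g where "g b = (\<chi> j. c j b)" for b
  have "row i A \<in> vec.span (g ` B)" for i
  proof -
    have "A $ i $ j = (\<Sum>b\<in>B. c j b * b $ i)" for j
      using arg_cong [OF c [of j], of "\<lambda>v. v $ i"] by (simp add: column_def)
    then have "row i A = (\<Sum>b\<in>B. b $ i *s g b)"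
      by (simp add: row_def g_def vec_eq_iff mult.commute)
    also have "\<dots> \<in> vec.span (g ` B)" by (intro vec.span_sum vec.span_scale vec.span_base) auto
    finally show ?thesis .
  qed
  then have "rows A \<subseteq> vec.span (g ` B)" by (auto simp: rows_def)
  then have "vec.dim (rows A) \<le> card (g ` B)" using fin by (intro vec.dim_le_card) auto
  also have "\<dots> \<le> card B" by (rule card_image_le [OF fin])
  finally show ?thesis using B(4) by simp
qed

lemma dim_range_transpose_le:
  fixes A :: "'f::field^'n^'n"
  shows "vec.dim (range ((*v) (transpose A))) \<le> vec.dim (range ((*v) A))"
proof -
  have "range ((*v) (transpose A)) \<subseteq> vec.span (rows A)"
    using matrix_vector_mult_in_columnspace_gen [of "transpose A"] by auto
  then have "vec.dim (range ((*v) (transpose A))) \<le> vec.dim (rows A)"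
    using vec.dim_subset vec.dim_span by metis
  also have "\<dots> \<le> vec.dim (columns A)" by (rule dim_rows_le_dim_columns_gen)
  also have "columns A \<subseteq> range ((*v) A)"
  proof -
    have "column j A = A *v axis j 1" for j by (simp add: vec_eq_iff column_def matrix_vector_mult_def axis_def if_distrib cong: if_cong)
    then show ?thesis by (auto simp: columns_def)
  qed
  then have "vec.dim (columns A) \<le> vec.dim (range ((*v) A))" by (rule vec.dim_subset)
  finally show ?thesis .
qed

lemma dim_range_transpose:
  fixes A :: "'f::field^'n^'n"
  shows "vec.dim (range ((*v) (transpose A))) = vec.dim (range ((*v) A))"
  using dim_range_transpose_le [of A] dim_range_transpose_le [of "transpose A"] by simp

section \<open>Counting vectors and matrices over the finite field\<close>

lemma card_subspace:
  fixes W :: "('f::{finite,field}^'n) set"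
  assumes "vec.subspace W"
  shows "card W = CARD('f) ^ vec.dim W"
proof -
  obtain B where B: "finite B" "B \<subseteq> W" "vec.independent B" "vec.span B = W" "card B = vec.dim W"
    using vec.basis_subspace_exists [OF assms] by metis
  let ?f = "\<lambda>c. \<Sum>b\<in>B. c b *s b"
  have "inj_on ?f (B \<rightarrow>\<^sub>E UNIV)"
  proof (rule inj_onI)
    fix c d assume cd: "c \<in> B \<rightarrow>\<^sub>E UNIV" "d \<in> B \<rightarrow>\<^sub>E UNIV" and "?f c = ?f d"
    then have "(\<Sum>b\<in>B. (c b - d b) *s b) = 0"
      by (simp add: vec.scale_left_diff_distrib sum_subtractf)
    moreover have "\<And>c. (\<Sum>b\<in>B. c b *s b) = 0 \<Longrightarrow> \<forall>b\<in>B. c b = 0"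
      using B(3) vec.independent_explicit by blast
    ultimately have "\<forall>b\<in>B. c b - d b = 0" by metis
    then show "c = d" using cd by (intro PiE_ext) auto
  qed
  moreover have "?f ` (B \<rightarrow>\<^sub>E UNIV) = W"
  proof
    show "?f ` (B \<rightarrow>\<^sub>E UNIV) \<subseteq> W"
      using B(2) assms by (auto intro!: vec.subspace_sum vec.subspace_scale)
    show "W \<subseteq> ?f ` (B \<rightarrow>\<^sub>E UNIV)"
    proof
      fix x assume "x \<in> W"
      then obtain c where "x = ?f c" using vec.span_finite [OF B(1)] B(4) by auto
      then have "x = ?f (restrict c B)" by simp
      moreover have "restrict c B \<in> B \<rightarrow>\<^sub>E UNIV" by simp
      ultimately show "x \<in> ?f ` (B \<rightarrow>\<^sub>E UNIV)" by (rule image_eqI)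
    qed
  qed
  ultimately have "card W = card (B \<rightarrow>\<^sub>E (UNIV :: 'f set))" using card_image by fastforce
  then show ?thesis using B(1,5) by (simp add: card_funcsetE)
qed

text \<open>Extend a basis \<open>B\<close> of \<open>U\<close> to a basis \<open>B'\<close> of
  \<open>V\<close>: such a matrix is determined by its values on \<open>B' - B\<close>, and these
  range freely over \<open>W\<close>.\<close>

lemma card_matrices_vanishing:
  fixes U W :: "('f::{finite,field}^'n) set"
  assumes "vec.subspace U" "vec.subspace W"
  shows "card {T :: 'f^'n^'n. range ((*v) T) \<subseteq> W \<and> (\<forall>x\<in>U. T *v x = 0)}
    = card W ^ (CARD('n) - vec.dim U)"
    (is "card ?S = _")
proof -
  obtain B where B: "finite B" "B \<subseteq> U" "vec.independent B" "vec.span B = U" "card B = vec.dim U"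
    using vec.basis_subspace_exists [OF assms(1)] by metis
  obtain B' where B': "B \<subseteq> B'" "vec.independent B'" "UNIV \<subseteq> vec.span B'"
    by (rule vec.maximal_independent_subset_extend [OF subset_UNIV B(3)])
  have fin: "finite B'" using B'(2) by (rule vec.finiteI_independent)
  have card: "card (B' - B) = CARD('n) - vec.dim U"
    using vec.basis_card_eq_dim [OF subset_UNIV B'(3,2)] B(5) card_Diff_subset [OF B(1) B'(1)]
    by (simp add: vec_dim_card card_cart_basis)
  let ?f = "\<lambda>T :: 'f^'n^'n. restrict ((*v) T) (B' - B)"
  have "inj_on ?f ?S"
  proof (rule inj_onI)
    fix S T assume ST: "S \<in> ?S" "T \<in> ?S" "?f S = ?f T"
    have "S *v b = T *v b" if "b \<in> B'" for b
      using ST B(2) that by (cases "b \<in> B") (auto dest: fun_cong [of _ _ b] simp: restrict_def)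
    then have "S *v x = T *v x" for x
      using vec.linear_eq_on [of "(*v) S" "(*v) T" x B'] B'(3) by auto
    then show "S = T" by (simp add: matrix_eq)
  qed
  moreover have "?f ` ?S = (B' - B) \<rightarrow>\<^sub>E W"
  proof
    show "?f ` ?S \<subseteq> (B' - B) \<rightarrow>\<^sub>E W" by (auto simp: image_subset_iff restrict_PiE_iff)
    show "(B' - B) \<rightarrow>\<^sub>E W \<subseteq> ?f ` ?S"
    proof
      fix h assume h: "h \<in> (B' - B) \<rightarrow>\<^sub>E W"
      obtain g where g: "Vector_Spaces.linear (*s) (*s) g"
        "\<forall>x\<in>B'. g x = (if x \<in> B then 0 else h x)"
        "range g = vec.span ((\<lambda>x. if x \<in> B then 0 else h x) ` B')"
        using vec.linear_independent_extend_subspace [OF B'(2), of "\<lambda>x. if x \<in> B then 0 else h x"] by blast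
      have T: "matrix g *v x = g x" for x by (rule matrix_works [OF g(1)])
      have "range g \<subseteq> W"
        unfolding g(3) using h vec.subspace_0 [OF assms(2)]
        by (intro vec.span_minimal assms(2)) auto
      moreover have "g x = 0" if "x \<in> U" for x
        by (rule vec.linear_eq_0_on_span [OF g(1), of B]) (use g(2) B' B(4) that in auto)
      ultimately have "matrix g \<in> ?S" by (auto simp: T)
      moreover have "h = ?f (matrix g)"
      proof
        show "h b = ?f (matrix g) b" for b
          using g(2) PiE_arb [OF h, of b] by (cases "b \<in> B' - B") (simp_all add: T)
      qed
      ultimately show "h \<in> ?f ` ?S" by blast
    qed
  qed
  ultimately have "card ?S = card ((B' - B) \<rightarrow>\<^sub>E W)" using card_image by fastforce
  then show ?thesis using fin card by (simp add: card_funcsetE)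
qed

text \<open>Subtracting a fixed projection \<open>Q\<close> onto \<open>W\<close> leaves exactly the
  matrices with image in \<open>W\<close> that vanish on \<open>W\<close>. The count is the power of
  \<open>q\<close> that \<open>eta_W\<close> divides by.\<close>

lemma card_projections:
  fixes W :: "('f::{finite,field}^'n) set"
  assumes "vec.subspace W"
  shows "card {T :: 'f^'n^'n. range ((*v) T) \<subseteq> W \<and> (\<forall>x\<in>W. T *v x = x)}
    = CARD('f) ^ (vec.dim W * (CARD('n) - vec.dim W))" (is "card ?S = _")
proof -
  obtain Q :: "'f^'n^'n" where Q: "range ((*v) Q) = W" "\<And>x. x \<in> W \<Longrightarrow> Q *v x = x"
    using exists_projection [OF assms] by metis
  let ?K = "{T :: 'f^'n^'n. range ((*v) T) \<subseteq> W \<and> (\<forall>x\<in>W. T *v x = 0)}"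
  have QW: "Q *v x \<in> W" for x using Q(1) by auto
  have "bij_betw (\<lambda>T. T - Q) ?S ?K"
    by (rule bij_betw_byWitness [where f' = "\<lambda>T. T + Q"])
      (auto simp: algebra_simps Q QW image_subset_iff intro!: vec.subspace_diff vec.subspace_add assms)
  then have "card ?S = card ?K" by (rule bij_betw_same_card)
  then show ?thesis
    using card_matrices_vanishing [OF assms assms] card_subspace [OF assms] by (simp add: power_mult)
qed

subsection \<open>Semi-idempotents\<close>

lemma funpow_stable:
  fixes f :: "'a \<Rightarrow> 'a"
  assumes "f ^^ Suc N = f ^^ N" "i \<ge> N"
  shows "f ^^ i = f ^^ N"
  using assms(2)
proof (induction rule: dec_induct)
  case (step i)
  then show ?case using assms(1) by (metis comp_apply funpow.simps(2))
qed auto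

lemma linear_funpow: "Vector_Spaces.linear (*s) (*s) f \<Longrightarrow> Vector_Spaces.linear (*s) (*s) (f ^^ i)"
  for f :: "'f::field^'n \<Rightarrow> 'f^'n"
  proof (induction i)
  case 0
  then show ?case by (metis funpow_0 id_apply vec.linear_id ext)
qed (auto intro: Vector_Spaces.linear_compose)

lemma srk_eq:
  assumes "((*v) T) ^^ Suc N = ((*v) T) ^^ N"
  shows "srk T = vec.dim (range (((*v) T) ^^ N))"
  unfolding srk_def
proof (rule the_equality)
  have "\<forall>i\<ge>N. vec.dim (range (((*v) T) ^^ i)) = vec.dim (range (((*v) T) ^^ N))"
    using funpow_stable [OF assms] by metis
  then show "\<exists>N'. \<forall>i\<ge>N'. vec.dim (range ((\<lambda>v. T *v v) ^^ i)) = vec.dim (range (((*v) T) ^^ N))"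
    by blast
  fix r assume "\<exists>N'. \<forall>i\<ge>N'. vec.dim (range ((\<lambda>v. T *v v) ^^ i)) = r"
  then obtain N' where "\<forall>i\<ge>N'. vec.dim (range ((\<lambda>v. T *v v) ^^ i)) = r" ..
  then show "r = vec.dim (range (((*v) T) ^^ N))"
    using funpow_stable [OF assms, of "max N N'"] by (metis max.cobounded1 max.cobounded2)
qed

text \<open>Fitting decomposition: if the powers are constant from exponent \<open>N\<close> on,
  \<open>?g\<close> is a projection commuting with \<open>T\<close>, and its range and kernel serve
  as \<open>X\<close> and \<open>Y\<close>. A condition on powers is easy to carry through swapping
  of factors and transposition.\<close>

lemma semi_idempotent_iff: "semi_idempotent T \<longleftrightarrow> (\<exists>N. ((*v) T) ^^ Suc N = ((*v) T) ^^ N)"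
proof
  assume "semi_idempotent T"
  then obtain X Y N where dec: "\<And>v. \<exists>x\<in>X. \<exists>y\<in>Y. v = x + y"
    and X: "\<And>x. x \<in> X \<Longrightarrow> T *v x = x" and N: "\<And>y. y \<in> Y \<Longrightarrow> (((*v) T) ^^ N) y = 0"
    unfolding semi_idempotent_def by metis
  have lin: "Vector_Spaces.linear (*s) (*s) (((*v) T) ^^ i)" for i
    by (rule linear_funpow) simp
  have "(((*v) T) ^^ Suc N) v = (((*v) T) ^^ N) v" for v
  proof -
    obtain x y where v: "x \<in> X" "y \<in> Y" "v = x + y" using dec by blast
    have "(((*v) T) ^^ i) x = x" for i by (induction i) (auto simp: X v)
    then have "(((*v) T) ^^ N) v = x"
      using v N by (simp add: vec.linear_add [OF lin])
    then show ?thesis using X v by simp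
  qed
  then show "\<exists>N. ((*v) T) ^^ Suc N = ((*v) T) ^^ N" by blast
next
  assume "\<exists>N. ((*v) T) ^^ Suc N = ((*v) T) ^^ N"
  then obtain N where N: "((*v) T) ^^ Suc N = ((*v) T) ^^ N" ..
  let ?g = "((*v) T) ^^ N"
  have lin: "Vector_Spaces.linear (*s) (*s) ?g" by (rule linear_funpow) simp
  have T: "T *v ?g x = ?g x" for x using N by (metis comp_apply funpow.simps(2))
  have gg: "?g (?g x) = ?g x" for x
    using funpow_stable [OF N, of "N + N"] by (metis comp_apply funpow_add le_add1)
  have swap: "?g (T *v x) = T *v ?g x" for x by (simp add: funpow_swap1)
  show "semi_idempotent T"
    unfolding semi_idempotent_def
  proof (intro exI conjI)
    show "vec.subspace (range ?g)"
      using vec.linear_subspace_image [OF lin vec.subspace_UNIV] .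
    show "vec.subspace {y. ?g y = 0}"
      using vec.linear_subspace_kernel [OF lin] .
    show "range ?g \<inter> {y. ?g y = 0} = {0}"
      using gg vec.linear_0 [OF lin] by (auto simp: image_iff)
    show "\<forall>v. \<exists>x\<in>range ?g. \<exists>y\<in>{y. ?g y = 0}. v = x + y"
    proof
      fix v
      have "?g (v - ?g v) = 0" by (simp add: vec.linear_diff [OF lin] gg)
      then show "\<exists>x\<in>range ?g. \<exists>y\<in>{y. ?g y = 0}. v = x + y"
        by (intro bexI [of _ "?g v"] bexI [of _ "v - ?g v"]) auto
    qed
    show "\<forall>y\<in>{y. ?g y = 0}. T *v y \<in> {y. ?g y = 0}" by (simp add: swap)
    show "\<forall>y\<in>{y. ?g y = 0}. ?g y = 0" by simp
  qed (auto simp: T)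
qed

section \<open>The weight \<open>chi\<close> and its symmetries\<close>

definition chi :: "'f::{finite,field}^'n^'n \<Rightarrow> 'k::field" where
  "chi T = (if semi_idempotent T then mu CARD('f) (srk T) else 0)"

lemma chi_eq:
  fixes T :: "'f::{finite,field}^'n^'n"
  assumes "((*v) T) ^^ Suc N = ((*v) T) ^^ N"
  shows "chi T = mu CARD('f) (vec.dim (range (((*v) T) ^^ N)))"
  using assms semi_idempotent_iff [of T] srk_eq [OF assms] by (auto simp: chi_def)

lemma funpow_comp_swap: "(f \<circ> g) ^^ Suc N = f \<circ> (g \<circ> f) ^^ N \<circ> g"
  by (induction N) (auto simp: fun_eq_iff)

text \<open>Since \<open>(A B)^(N+1) = A (B A)^N B\<close>, stabilisation passes from
  \<open>B A\<close> to \<open>A B\<close> one exponent later, and the rank cannot grow on the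
  way.\<close>

lemma chi_mult_commute_aux:
  fixes A B :: "'f::{finite,field}^'n^'n"
  assumes "((*v) (B ** A)) ^^ Suc N = ((*v) (B ** A)) ^^ N"
  shows "((*v) (A ** B)) ^^ Suc (Suc N) = ((*v) (A ** B)) ^^ Suc N"
    and "vec.dim (range (((*v) (A ** B)) ^^ Suc N)) \<le> vec.dim (range (((*v) (B ** A)) ^^ N))"
proof -
  have comp: "(*v) (A ** B) = (*v) A \<circ> (*v) B" "(*v) (B ** A) = (*v) B \<circ> (*v) A"
    by (auto simp: fun_eq_iff matrix_vector_mul_assoc)
  have AB: "((*v) (A ** B)) ^^ Suc i = (*v) A \<circ> ((*v) (B ** A)) ^^ i \<circ> (*v) B" for i
    unfolding comp by (rule funpow_comp_swap)
  show "((*v) (A ** B)) ^^ Suc (Suc N) = ((*v) (A ** B)) ^^ Suc N"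
    by (simp only: AB assms)
  have "range (((*v) (A ** B)) ^^ Suc N) \<subseteq> (*v) A ` range (((*v) (B ** A)) ^^ N)"
    unfolding AB by auto
  then have "vec.dim (range (((*v) (A ** B)) ^^ Suc N)) \<le> vec.dim ((*v) A ` range (((*v) (B ** A)) ^^ N))"
    by (rule vec.dim_subset)
  also have "\<dots> \<le> vec.dim (range (((*v) (B ** A)) ^^ N))"
    by (rule vec.dim_image_le) simp
  finally show "vec.dim (range (((*v) (A ** B)) ^^ Suc N)) \<le> vec.dim (range (((*v) (B ** A)) ^^ N))" .
qed

lemma chi_mult_commute:
  fixes A B :: "'f::{finite,field}^'n^'n"
  shows "(chi (A ** B) :: 'k::field) = chi (B ** A)"
proof (cases "semi_idempotent (B ** A)")
  case True
  then obtain N where N: "((*v) (B ** A)) ^^ Suc N = ((*v) (B ** A)) ^^ N"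
    using semi_idempotent_iff by blast
  note 1 = chi_mult_commute_aux [OF N]
  \<comment> \<open>Swapping back bounds the rank for \<open>A ** B\<close> from below: the powers
    of \<open>B ** A\<close> with exponents \<open>N\<close> and \<open>N + 2\<close> coincide, so
    the two inequalities close up.\<close>
  note 2 = chi_mult_commute_aux [OF 1(1)]
  have "vec.dim (range (((*v) (B ** A)) ^^ Suc (Suc N))) = vec.dim (range (((*v) (B ** A)) ^^ N))"
    using funpow_stable [OF N, of "Suc (Suc N)"] by simp
  then have "vec.dim (range (((*v) (A ** B)) ^^ Suc N)) = vec.dim (range (((*v) (B ** A)) ^^ N))"
    using 1(2) 2(2) by linarith
  then show ?thesis using chi_eq [OF 1(1)] chi_eq [OF N] by metis
next
  case False
  then have "\<not> semi_idempotent (A ** B)"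
    using chi_mult_commute_aux(1) semi_idempotent_iff by blast
  with False show ?thesis by (simp add: chi_def)
qed

lemma chi_transpose:
  fixes T :: "'f::{finite,field}^'n^'n"
  shows "(chi (transpose T) :: 'k::field) = chi T"
proof -
  \<comment> \<open>Powers are kept as matrices, since transposition acts on matrices and not on
    iterated maps; the ranks then agree because row rank equals column rank.\<close>
  define P where "P T i = (((**) T) ^^ i) (mat 1)" for T :: "'f^'n^'n" and i
  have P: "((*v) T) ^^ i = (*v) (P T i)" for T i
    by (induction i) (auto simp: P_def fun_eq_iff matrix_vector_mul_assoc [symmetric])
  have comm: "P T i ** T = T ** P T i" for T i
    by (induction i) (auto simp: P_def matrix_mul_assoc [symmetric])
  have tr: "transpose (P T i) = P (transpose T) i" for T i
  proof (induction i)
    case (Suc i)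
    have "transpose (P T (Suc i)) = transpose (P T i) ** transpose T"
      by (simp add: P_def matrix_transpose_mul)
    also have "\<dots> = P (transpose T) (Suc i)" using Suc comm [of "transpose T" i] by (simp add: P_def)
    finally show ?case .
  qed (simp add: P_def transpose_mat)
  have stab: "((*v) (transpose T)) ^^ Suc N = ((*v) (transpose T)) ^^ N"
    if "((*v) T) ^^ Suc N = ((*v) T) ^^ N" for T :: "'f^'n^'n" and N
  proof -
    have "P T (Suc N) = P T N" using that unfolding P by (simp add: matrix_eq fun_eq_iff)
    then show ?thesis unfolding P by (metis tr)
  qed
  show ?thesis
  proof (cases "semi_idempotent T")
    case True
    then obtain N where N: "((*v) T) ^^ Suc N = ((*v) T) ^^ N"
      using semi_idempotent_iff by blast
    have "vec.dim (range (((*v) (transpose T)) ^^ N)) = vec.dim (range (((*v) T) ^^ N))"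
      unfolding P tr [symmetric] by (rule dim_range_transpose)
    then show ?thesis using chi_eq [OF N] chi_eq [OF stab [OF N]] by metis
  next
    case False
    then have "\<not> semi_idempotent (transpose T)"
      using stab [where T = "transpose T"] unfolding semi_idempotent_iff transpose_transpose by blast
    with False show ?thesis by (simp add: chi_def)
  qed
qed

text \<open>A stable power of \<open>T\<close> kills \<open>T *v x - x\<close>, which lies in
  \<open>S\<close>, while all powers of \<open>T\<close> have trivial kernel on the
  \<open>T\<close>-stable subspace \<open>S\<close>.\<close>

lemma semi_idempotent_fixes:
  fixes T :: "'f::{finite,field}^'n^'n"
  assumes "semi_idempotent T" "vec.subspace S" "\<And>x. x \<in> S \<Longrightarrow> T *v x \<in> S"
    and inj: "\<And>x. x \<in> S \<Longrightarrow> T *v x = 0 \<Longrightarrow> x = 0" and "x \<in> S"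
  shows "T *v x = x"
proof -
  obtain N where N: "((*v) T) ^^ Suc N = ((*v) T) ^^ N"
    using assms(1) semi_idempotent_iff by blast
  have lin: "Vector_Spaces.linear (*s) (*s) (((*v) T) ^^ N)"
    by (rule linear_funpow) simp
  have "(((*v) T) ^^ N) (T *v x) = (((*v) T) ^^ N) x"
    using N by (metis comp_apply funpow_Suc_right)
  then have "(((*v) T) ^^ N) (T *v x - x) = 0" by (simp add: vec.linear_diff [OF lin])
  moreover have "(((*v) T) ^^ i) y = 0 \<Longrightarrow> y = 0" if "y \<in> S" for i y
    using that by (induction i arbitrary: y) (auto simp: funpow_swap1 intro: inj assms(3))
  moreover have "T *v x - x \<in> S" using assms by (intro vec.subspace_diff) auto
  ultimately show ?thesis by (metis eq_iff_diff_eq_0)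
qed

lemma chi_eq_0:
  fixes T :: "'f::{finite,field}^'n^'n"
  assumes "vec.subspace S" "\<And>x. x \<in> S \<Longrightarrow> T *v x \<in> S"
    and "\<And>x. x \<in> S \<Longrightarrow> T *v x = 0 \<Longrightarrow> x = 0" and "x \<in> S" "T *v x \<noteq> x"
  shows "chi T = (0 :: 'k::field)"
proof -
  have "\<not> semi_idempotent T"
  proof
    assume "semi_idempotent T"
    then have "T *v x = x" by (rule semi_idempotent_fixes) (use assms(1-4) in blast)+
    with assms(5) show False ..
  qed
  then show ?thesis by (simp add: chi_def)
qed

lemma chi_projection:
  fixes T :: "'f::{finite,field}^'n^'n"
  assumes "range ((*v) T) \<subseteq> W" "\<And>x. x \<in> W \<Longrightarrow> T *v x = x"
  shows "chi T = mu CARD('f) (vec.dim W)"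
proof -
  have "((*v) T) ^^ Suc 1 = ((*v) T) ^^ 1" using assms by (auto simp: fun_eq_iff)
  moreover have "range ((*v) T ^^ 1) = W"
    using assms by (auto simp: image_iff) metis
  ultimately show ?thesis using chi_eq by metis
qed

text \<open>Read as \<open>q^d * mu q d + mu q (Suc d) = 0\<close>, this is the cancellation behind
  the vanishing of the coset sums.\<close>

lemma mu_Suc: "mu q (Suc d) = - (of_nat q ^ d * mu q d)"
proof -
  have "Suc d choose 2 = (d choose 2) + d"
    by (metis add.commute binomial_Suc_Suc choose_one numeral_2_eq_2 One_nat_def)
  then show ?thesis by (simp add: mu_def power_add)
qed

text \<open>
  Induction on \<open>dim W\<close>. Let \<open>H = W \<inter> ker p\<close>; all \<open>M + w \<otimes> p\<close> agree with \<open>M\<close> on \<open>H\<close>, and shifting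
  \<open>w\<close> allows \<open>M u = 0\<close> for a chosen \<open>u\<close> with \<open>p u = 1\<close>. If \<open>M\<close> kills some \<open>l \<noteq> 0\<close> in \<open>H\<close>, project \<open>l\<close>
  away. Otherwise \<open>M + w \<otimes> p\<close> is injective on \<open>W\<close> for \<open>w \<notin> M H\<close>, so it can be semi-idempotent only
  if it is the identity on \<open>W\<close>. If \<open>M H \<noteq> H\<close> this never happens, and the terms with \<open>w \<in> M H\<close> are
  covered by the induction hypothesis for \<open>M H\<close>. If \<open>M H = H\<close>, nonzero terms require \<open>M\<close> to be the
  identity on \<open>H\<close>, and then the sum is \<open>q\<^bsup>d-1\<^esup> \<mu> (d - 1) + \<mu> d = 0\<close>.
\<close>

lemma sum_chi_coset:
  fixes W :: "('f::{finite,field}^'n) set" and M :: "'f^'n^'n"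
  assumes "vec.subspace W" "range ((*v) M) \<subseteq> W" "u \<in> W" "dotv p u \<noteq> 0"
  shows "(\<Sum>w\<in>W. chi (M + outer w p)) = (0 :: 'k::field)"
  using assms
proof (induction "vec.dim W" arbitrary: W M p u rule: less_induct)
  case less
  note W = less.prems(1)
  let ?H = "{x \<in> W. dotv p x = 0}"
  let ?T = "\<lambda>M w. M + outer w p"
  have H: "vec.subspace ?H" by (rule subspace_kernel_dotv [OF W])
  have normalise: "(\<Sum>w\<in>W. chi (?T M w)) = (\<Sum>w\<in>W. chi (?T (M - outer (M *v u) p) w) :: 'k)" for u
  proof -
    have "M *v u \<in> W" using less.prems(2) by auto
    then have "bij_betw (\<lambda>w. w - M *v u) W W"
      by (intro bij_betw_byWitness [where f' = "\<lambda>w. w + M *v u"])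
        (auto intro: vec.subspace_diff vec.subspace_add W)
    then have "(\<Sum>w\<in>W. chi (?T M w)) = (\<Sum>w\<in>W. chi (?T M (w - M *v u)) :: 'k)"
      by (rule sum.reindex_bij_betw [symmetric])
    then show ?thesis by (simp add: outer_diff_left algebra_simps)
  qed
  define u1 where "u1 = (1 / dotv p u) *s u"
  have u1: "u1 \<in> W" "dotv p u1 = 1"
    using less.prems(3,4) W by (auto simp: u1_def intro: vec.subspace_scale)
  show ?case
  proof (cases "\<exists>l\<in>?H. l \<noteq> 0 \<and> M *v l = 0")
    case True
    then obtain l where l: "l \<in> W" "dotv p l = 0" "l \<noteq> 0" "M *v l = 0" by auto
    obtain k where k: "dotv k l = 1" using exists_dotv_eq_1 [OF l(3)] by blast
    define \<pi> where "\<pi> = mat 1 - outer l k"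
    have \<pi>: "\<pi> *v x = x - dotv k x *s l" for x by (simp add: \<pi>_def algebra_simps)
    let ?W = "{x \<in> W. dotv k x = 0}"
    have W': "vec.subspace ?W" by (rule subspace_kernel_dotv [OF W])
    have \<pi>W: "\<pi> *v x \<in> ?W" if "x \<in> W" for x
      using that l(1) k by (auto simp: \<pi> intro: vec.subspace_diff vec.subspace_scale W)
    \<comment> \<open>Both \<open>M\<close> and \<open>p\<close> kill \<open>l\<close>, so
      \<open>?T M w\<close> absorbs \<open>\<pi>\<close> on the right; moving \<open>\<pi>\<close>
      to the left by \<open>chi_mult_commute\<close> puts the image inside
      \<open>?W\<close>.\<close>
    have chi: "chi (?T M w) = (chi (\<pi> ** M + outer (\<pi> *v w) p) :: 'k)" for w
    proof -
      have "?T M w ** \<pi> = ?T M w"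
        by (simp add: matrix_eq matrix_vector_mul_assoc [symmetric] \<pi> l vec.diff vec.scale matrix_vector_mult_add_rdistrib)
      moreover have "\<pi> ** ?T M w = \<pi> ** M + outer (\<pi> *v w) p"
        by (simp add: matrix_add_ldistrib matrix_mult_outer)
      ultimately show ?thesis by (metis chi_mult_commute)
    qed
    \<comment> \<open>\<open>W\<close> is \<open>?W\<close> plus the line through \<open>l\<close>,
      and \<open>\<pi>\<close> forgets that line: the sum over \<open>W\<close> becomes
      \<open>q\<close> copies of a sum over the smaller space \<open>?W\<close>.\<close>
    have bij: "bij_betw (\<lambda>(a, w). w + a *s l) (UNIV \<times> ?W) W"
      using k l(1) W
      by (intro bij_betw_byWitness [where f' = "\<lambda>w. (dotv k w, \<pi> *v w)"])
        (auto simp: \<pi> intro: vec.subspace_diff vec.subspace_add vec.subspace_scale)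
    have "(\<Sum>w\<in>W. chi (?T M w)) = (\<Sum>w\<in>W. chi (\<pi> ** M + outer (\<pi> *v w) p) :: 'k)"
      by (simp add: chi)
    also have "\<dots> = (\<Sum>(a, w)\<in>UNIV \<times> ?W. chi (\<pi> ** M + outer (\<pi> *v (w + a *s l)) p))"
      using sum.reindex_bij_betw [OF bij, of "\<lambda>w. chi (\<pi> ** M + outer (\<pi> *v w) p) :: 'k"]
      by (simp add: case_prod_unfold)
    also have "\<dots> = (\<Sum>(a, w)\<in>(UNIV :: 'f set) \<times> ?W. chi (\<pi> ** M + outer w p))"
      by (intro sum.cong) (auto simp: \<pi> k)
    also have "\<dots> = (\<Sum>a\<in>(UNIV :: 'f set). \<Sum>w\<in>?W. chi (\<pi> ** M + outer w p))"
      by (rule sum.cartesian_product [symmetric])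
    also have "(\<Sum>w\<in>?W. chi (\<pi> ** M + outer w p)) = (0 :: 'k)"
    proof (rule less.hyps [OF _ W', of _ "\<pi> *v u"])
      show "vec.dim ?W < vec.dim W"
        by (rule dim_less_of_notin [OF W' W _ l(1)]) (use k in auto)
      show "range ((*v) (\<pi> ** M)) \<subseteq> ?W"
        using \<pi>W less.prems(2) by (auto simp: matrix_vector_mul_assoc [symmetric])
      show "\<pi> *v u \<in> ?W" using \<pi>W less.prems(3) .
      show "dotv p (\<pi> *v u) \<noteq> 0" using less.prems(4) by (simp add: \<pi> l)
    qed
    finally show ?thesis by simp
  next
    case False
    then have inj: "\<And>x. x \<in> ?H \<Longrightarrow> M *v x = 0 \<Longrightarrow> x = 0" by blast
    let ?W1 = "(*v) M ` ?H"
    have W1: "vec.subspace ?W1" by (rule vec.linear_subspace_image [OF _ H]) simp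
    have W1W: "?W1 \<subseteq> W" using less.prems(2) by auto
    have dimW1: "vec.dim ?W1 = vec.dim ?H" by (rule dim_image_eq_of_trivial_kernel [OF H inj])
    have dimH: "vec.dim ?H < vec.dim W"
      by (rule dim_less_of_notin [OF H W _ u1(1)]) (use u1 in auto)
    have decomp: "\<exists>h\<in>?H. \<exists>c. x = h + c *s u" if "x \<in> W" "u \<in> W" "dotv p u = 1" for x u
      using that W
      by (intro bexI [of _ "x - dotv p x *s u"] exI [of _ "dotv p x"])
        (auto intro: vec.subspace_diff vec.subspace_scale)
    \<comment> \<open>Writing \<open>x = h + c *s u\<close>, the equation becomes
      \<open>M *v h + c *s w = 0\<close>. A nonzero \<open>c\<close> would put \<open>w\<close> into
      \<open>?W1\<close>, so \<open>c = 0\<close>, and then \<open>h = 0\<close> because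
      \<open>M\<close> has trivial kernel on \<open>?H\<close>.\<close>
    have T_inj: "x = 0"
      if M: "\<And>x. x \<in> ?H \<Longrightarrow> M' *v x = M *v x" "M' *v u = 0" and u: "u \<in> W" "dotv p u = 1"
        and w: "w \<notin> ?W1" and x: "x \<in> W" "?T M' w *v x = 0" for M' u w x
    proof -
      obtain h c where h: "h \<in> ?H" "x = h + c *s u" using decomp [OF x(1) u] by blast
      then have eq: "M *v h + c *s w = 0"
        using x(2) M u by (simp add: algebra_simps vec.scale vec.add)
      have "c = 0"
      proof (rule ccontr)
        assume "c \<noteq> 0"
        have "- (c *s w) = M *v h" using eq by (simp add: eq_neg_iff_add_eq_0 add.commute neg_eq_iff_add_eq_0)
        then have "- (c *s w) \<in> ?W1" using h(1) by blast
        then have "(- (1 / c)) *s (- (c *s w)) \<in> ?W1" by (rule vec.subspace_scale [OF W1])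
        then show False using w \<open>c \<noteq> 0\<close> by (simp add: vec.scale_minus_right vec.scale_minus_left)
      qed
      then show "x = 0" using eq h inj by simp
    qed
    show ?thesis
    proof (cases "?W1 = ?H")
      case False
      have "\<not> ?W1 \<subseteq> ?H"
        using vec.subspace_dim_equal [OF W1 H] dimW1 False by auto
      \<comment> \<open>Taking \<open>u\<close> inside \<open>?W1\<close> supplies the vector of
        \<open>?W1\<close> on which the induction hypothesis needs a nonzero functional. With
        \<open>u\<close> killed, \<open>M'\<close> maps all of \<open>W\<close> into
        \<open>?W1\<close>.\<close>
      then obtain u0 where u0: "u0 \<in> ?W1" "dotv p u0 \<noteq> 0" using W1W by blast
      define u where "u = (1 / dotv p u0) *s u0"
      have u: "u \<in> ?W1" "u \<in> W" "dotv p u = 1"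
        using u0 W1W vec.subspace_scale [OF W1 u0(1)] by (auto simp: u_def)
      define M' where "M' = M - outer (M *v u) p"
      have M': "M' *v u = 0" "\<And>x. x \<in> ?H \<Longrightarrow> M' *v x = M *v x"
        using u by (simp_all add: M'_def algebra_simps)
      have M'W: "range ((*v) M') \<subseteq> W"
        using less.prems(2) W by (auto simp: M'_def algebra_simps intro!: vec.subspace_diff vec.subspace_scale)
      have M'W1: "M' *v x \<in> ?W1" if "x \<in> W" for x
        using decomp [OF that u(2,3)] M' by (auto simp: vec.add vec.scale)
      \<comment> \<open>\<open>M'\<close> is known to send \<open>W\<close> into \<open>?W1\<close>,
        but the induction hypothesis asks this of all of \<open>V\<close>. Precomposing with a
        projection onto \<open>W\<close> repairs this and leaves \<open>chi\<close> unchanged,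
        because \<open>Q ** ?T M' w = ?T M' w\<close>.\<close>
      obtain Q :: "'f^'n^'n" where Q: "range ((*v) Q) = W" "\<And>x. x \<in> W \<Longrightarrow> Q *v x = x"
        using exists_projection [OF W] by metis
      have QW: "Q *v x \<in> W" for x using Q(1) by auto
      have TW: "range ((*v) (?T M' w)) \<subseteq> W" if "w \<in> W" for w
        using M'W that W by (auto simp: algebra_simps intro!: vec.subspace_add vec.subspace_scale)
      have "(\<Sum>w\<in>W. chi (?T M w)) = (\<Sum>w\<in>W. chi (?T M' w) :: 'k)"
        unfolding M'_def by (rule normalise)
      also have "\<dots> = (\<Sum>w\<in>?W1. chi (?T M' w))"
      proof (rule sum.mono_neutral_right [OF _ W1W], safe)
        fix w assume w: "w \<in> W" "w \<notin> ?W1"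
        have "\<exists>h\<in>?H. M *v h \<noteq> h"
        proof (rule ccontr)
          assume "\<not> ?thesis"
          then have "?W1 = ?H" by (auto simp: image_iff)
          with False show False by simp
        qed
        then obtain h where h: "h \<in> ?H" "M *v h \<noteq> h" by blast
        show "chi (?T M' w) = (0 :: 'k)"
        proof (rule chi_eq_0 [OF W])
          show "?T M' w *v x \<in> W" for x using TW [OF w(1)] by auto
          show "x = 0" if "x \<in> W" "?T M' w *v x = 0" for x
            using T_inj [OF M'(2,1) u(2,3) w(2) that] .
          show "h \<in> W" using h by simp
          show "?T M' w *v h \<noteq> h" using h M'(2) by (simp add: algebra_simps)
        qed
      qed simp
      also have "\<dots> = (\<Sum>w\<in>?W1. chi (M' ** Q + outer w (p v* Q)))"
      proof (rule sum.cong [OF refl])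
        fix w assume "w \<in> ?W1"
        then have w: "w \<in> W" using W1W by blast
        have eq: "M' ** Q + outer w (p v* Q) = ?T M' w ** Q"
          by (simp add: matrix_eq matrix_vector_mul_assoc [symmetric] matrix_vector_mult_add_rdistrib
              dotv_vector_matrix_mult)
        have "Q ** ?T M' w = ?T M' w"
          using TW [OF w] Q(2) by (force simp: matrix_eq matrix_vector_mul_assoc [symmetric])
        then show "chi (?T M' w) = (chi (M' ** Q + outer w (p v* Q)) :: 'k)"
          unfolding eq by (metis chi_mult_commute)
      qed
      also have "\<dots> = 0"
      proof (rule less.hyps [OF _ W1 _ u(1)])
        show "vec.dim ?W1 < vec.dim W" using dimW1 dimH by simp
        show "range ((*v) (M' ** Q)) \<subseteq> ?W1"
          using M'W1 QW by (auto simp: matrix_vector_mul_assoc [symmetric])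
        show "dotv (p v* Q) u \<noteq> 0" using u Q(2) by (simp add: dotv_vector_matrix_mult)
      qed
      finally show ?thesis .
    next
      case True
      define M' where "M' = M - outer (M *v u1) p"
      have M': "M' *v u1 = 0" "\<And>x. x \<in> ?H \<Longrightarrow> M' *v x = M *v x"
        using u1 by (simp_all add: M'_def algebra_simps)
      have M'W: "range ((*v) M') \<subseteq> W"
        using less.prems(2) W by (auto simp: M'_def algebra_simps intro!: vec.subspace_diff vec.subspace_scale)
      have TW: "?T M' w *v x \<in> W" if "w \<in> W" for w x
        using M'W that W by (auto simp: algebra_simps intro!: vec.subspace_add vec.subspace_scale)
      have TH: "?T M' w *v x = M *v x" if "x \<in> ?H" for w x
        using that M'(2) by (simp add: algebra_simps)
      have Tu: "?T M' w *v u1 = w" for w using M'(1) u1 by (simp add: algebra_simps)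
      have "(\<Sum>w\<in>W. chi (?T M' w)) = (0 :: 'k)"
      proof (cases "\<exists>h\<in>?H. M *v h \<noteq> h")
        case True
        then obtain h where h: "h \<in> ?H" "M *v h \<noteq> h" by blast
        have "chi (?T M' w) = (0 :: 'k)" if "w \<in> W" for w
        proof (rule chi_eq_0 [OF H])
          show "?T M' w *v x \<in> ?H" if "x \<in> ?H" for x
            unfolding TH [OF that] using that \<open>?W1 = ?H\<close> by blast
          show "x = 0" if "x \<in> ?H" "?T M' w *v x = 0" for x
            using inj that TH by metis
        qed (use h TH in auto)
        then show ?thesis by simp
      next
        case False
        then have MH: "\<And>x. x \<in> ?H \<Longrightarrow> M *v x = x" by blast
        have dimW: "vec.dim W = Suc (vec.dim ?H)"
          by (rule dim_kernel_dotv(1) [OF W u1(1)]) (simp add: u1)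
        \<comment> \<open>\<open>?S\<close> maps \<open>V\<close> into \<open>W\<close>, maps
          \<open>W\<close> into \<open>?H\<close>, and fixes \<open>?H\<close> pointwise, so its
          square is a projection onto \<open>?H\<close>.\<close>
        have in_H: "chi (?T M' w) = (mu CARD('f) (vec.dim ?H) :: 'k)" if w: "w \<in> ?H" for w
        proof -
          let ?S = "?T M' w"
          have S_W: "?S *v x \<in> ?H" if "x \<in> W" for x
          proof -
            obtain h c where h: "h \<in> ?H" "x = h + c *s u1" using decomp [OF \<open>x \<in> W\<close> u1] by blast
            then have "?S *v x = h + c *s w"
              using TH [OF h(1)] Tu MH [OF h(1)] by (simp only: vec.add vec.scale)
            then show ?thesis
              using vec.subspace_add [OF H h(1) vec.subspace_scale [OF H w, of c]] by (simp only:)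
          qed
          have S_H: "?S *v x = x" if "x \<in> ?H" for x using that TH MH by metis
          have S2: "?S *v (?S *v x) \<in> ?H" for x using S_W TW w by blast
          then have "((*v) ?S) ^^ Suc 2 = ((*v) ?S) ^^ 2"
            using S_H by (auto simp: fun_eq_iff numeral_2_eq_2)
          moreover have "range (((*v) ?S) ^^ 2) = ?H"
          proof
            show "range (((*v) ?S) ^^ 2) \<subseteq> ?H" using S2 by (auto simp: numeral_2_eq_2)
            show "?H \<subseteq> range (((*v) ?S) ^^ 2)"
            proof
              fix x assume "x \<in> ?H"
              then have "x = (((*v) ?S) ^^ 2) x" using S_H by (simp add: numeral_2_eq_2)
              then show "x \<in> range (((*v) ?S) ^^ 2)" by blast
            qed
          qed
          ultimately show ?thesis using chi_eq by metis
        qed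
        \<comment> \<open>An operator injective on \<open>W\<close> with nonzero weight must fix
          \<open>u1\<close>, whose image is \<open>w\<close>. So only \<open>w = u1\<close>
          survives, and there the operator is the identity on \<open>W\<close>.\<close>
        have notin_H: "chi (?T M' w) = (if w = u1 then mu CARD('f) (vec.dim W) else 0 :: 'k)"
          if w: "w \<in> W - ?H" for w
        proof (cases "w = u1")
          case True
          have "?T M' u1 *v x = x" if "x \<in> W" for x
          proof -
            obtain h c where h: "h \<in> ?H" "x = h + c *s u1" using decomp [OF \<open>x \<in> W\<close> u1] by blast
            then show ?thesis
              using TH [OF h(1)] Tu MH [OF h(1)] by (simp only: vec.add vec.scale)
          qed
          then show ?thesis using True chi_projection [of "?T M' u1" W] TW u1(1) by auto
        next
          case False
          have "chi (?T M' w) = (0 :: 'k)"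
          proof (rule chi_eq_0 [OF W])
            show "x = 0" if "x \<in> W" "?T M' w *v x = 0" for x
              using T_inj [OF M'(2,1) u1 _ that] w \<open>?W1 = ?H\<close> by blast
          qed (use TW w u1 Tu False in auto)
          then show ?thesis using False by simp
        qed
        have "(\<Sum>w\<in>W. chi (?T M' w)) = (\<Sum>w\<in>?H. chi (?T M' w)) + (\<Sum>w\<in>W - ?H. chi (?T M' w) :: 'k)"
          using sum.subset_diff [of ?H W] by (auto simp: add.commute)
        also have "(\<Sum>w\<in>?H. chi (?T M' w)) = (of_nat CARD('f) ^ vec.dim ?H * mu CARD('f) (vec.dim ?H) :: 'k)"
          using in_H card_subspace [OF H] by simp
        also have "(\<Sum>w\<in>W - ?H. chi (?T M' w)) = (\<Sum>w\<in>W - ?H. if w = u1 then mu CARD('f) (vec.dim W) else 0 :: 'k)"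
          using notin_H by (intro sum.cong) auto
        also have "\<dots> = mu CARD('f) (vec.dim W)" using u1 by (simp add: sum.delta)
        finally show ?thesis by (simp add: dimW mu_Suc)
      qed
      then show ?thesis using normalise [of u1] unfolding M'_def by simp
    qed
  qed
qed

subsection \<open>Counting subspaces\<close>

lemma qbinom_eq_0: "a < b \<Longrightarrow> qbinom q a b = 0"
  by (induction q a b rule: qbinom.induct) auto

lemma qbinom_0_right [simp]: "qbinom q a 0 = 1"
  by (cases a) auto

text \<open>The second \<open>q\<close>-Pascal rule, with the power of \<open>q\<close> on the other
  term than in the recursion: expand by the recursion, apply the induction hypothesis to both terms
  and regroup. This is the form produced by splitting subspaces along a hyperplane.\<close>

lemma qbinom_Suc_Suc':
  "b \<le> a \<Longrightarrow> qbinom q (Suc a) (Suc b) = q ^ (a - b) * qbinom q a b + qbinom q a (Suc b)"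
proof (induction a arbitrary: b)
  case (Suc a)
  show ?case
  proof (cases b)
    case 0
    then show ?thesis using Suc.IH [of 0] by (simp add: algebra_simps)
  next
    case b: (Suc b')
    show ?thesis
    proof (cases "b = Suc a")
      case True
      then show ?thesis by (simp add: qbinom_eq_0)
    next
      case False
      then have le: "b \<le> a" "b' \<le> a" using Suc.prems b by auto
      obtain c where a: "a = b + c" using le(1) le_Suc_ex by blast
      have "qbinom q (Suc (Suc a)) (Suc b) = qbinom q (Suc a) (Suc b') + q ^ Suc b * qbinom q (Suc a) (Suc b)"
        by (simp add: b)
      also have "\<dots> = q ^ (a - b') * qbinom q a b' + qbinom q a b
          + q ^ Suc b * (q ^ (a - b) * qbinom q a b + qbinom q a (Suc b))"
        using Suc.IH [OF le(1)] Suc.IH [OF le(2)] b by simp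
      also have "\<dots> = q ^ (Suc a - b) * (qbinom q a b' + q ^ b * qbinom q a b)
          + (qbinom q a b + q ^ Suc b * qbinom q a (Suc b))"
        by (simp add: a b algebra_simps power_add)
      also have "\<dots> = q ^ (Suc a - b) * qbinom q (Suc a) b + qbinom q (Suc a) (Suc b)"
        by (simp add: b)
      finally show ?thesis .
    qed
  qed
qed simp

text \<open>Count pairs of a subspace \<open>W\<close> from the left-hand set and a vector
  \<open>w\<close> in \<open>W - H\<close> in two ways. Sending them to
  \<open>(W \<inter> H, w)\<close> is undone by adjoining \<open>w\<close>; \<open>W - H\<close> has
  \<open>(q - 1) q^d\<close> elements and \<open>U - H\<close> has \<open>(q - 1) q^(dim H)\<close>.
  Powers on both sides avoid a division.\<close>

lemma card_subspaces_between_aux: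
  fixes R U :: "('f::{finite,field}^'n) set"
  assumes U: "vec.subspace U" and H: "H = {x \<in> U. dotv p x = 0}" and R: "R \<subseteq> H"
    and u: "u \<in> U" "dotv p u \<noteq> 0"
  shows "card {W. vec.subspace W \<and> R \<subseteq> W \<and> W \<subseteq> U \<and> vec.dim W = Suc d \<and> \<not> W \<subseteq> H} * CARD('f) ^ d
    = CARD('f) ^ vec.dim H * card {W. vec.subspace W \<and> R \<subseteq> W \<and> W \<subseteq> H \<and> vec.dim W = d}"
    (is "card ?A * _ = _ * card ?B")
proof -
  let ?q = "CARD('f)"
  have q: "?q > 1"
  proof -
    have "card {0, 1 :: 'f} \<le> ?q" by (rule card_mono) auto
    then show ?thesis by simp
  qed
  have ker: "W \<inter> H = {x \<in> W. dotv p x = 0}" if "W \<subseteq> U" for W using that H by auto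
  have subH: "vec.subspace H" unfolding H by (rule subspace_kernel_dotv [OF U])
  have complement: "card (W - H) = (?q - 1) * ?q ^ e"
    if W: "vec.subspace W" "W \<subseteq> U" "\<not> W \<subseteq> H" "vec.dim W = Suc e" for W e
  proof -
    obtain w where w: "w \<in> W" "dotv p w \<noteq> 0" using W(2,3) unfolding H by blast
    have "vec.dim (W \<inter> H) = e"
      using dim_kernel_dotv(1) [OF W(1) w] W(4) by (simp add: ker [OF W(2)])
    then have "card (W \<inter> H) = ?q ^ e"
      using card_subspace [OF vec.subspace_inter [OF W(1) subH]] by simp
    then show ?thesis
      using card_Diff_subset_Int [of W H] card_subspace [OF W(1)] W(4)
      by (simp add: algebra_simps)
  qed
  have dimU: "vec.dim U = Suc (vec.dim H)" using dim_kernel_dotv(1) [OF U u] H by simp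
  define A where "A = ?A"
  define B where "B = ?B"
  have "bij_betw (\<lambda>(W, w). (W \<inter> H, w)) (SIGMA W:A. W - H) (B \<times> (U - H))"
  proof (rule bij_betw_byWitness [where f' = "\<lambda>(W, w). (vec.span (insert w W), w)"])
    have 1: "vec.span (insert w (W \<inter> H)) = W" "W \<inter> H \<in> B" "w \<in> U - H"
      if "W \<in> A" "w \<in> W - H" for W w
    proof -
      have w: "w \<in> W" "dotv p w \<noteq> 0" using that H A_def by auto
      have sub: "vec.subspace W" "W \<subseteq> U" "vec.dim W = Suc d" using that A_def by auto
      have "vec.dim (W \<inter> H) = d"
        using dim_kernel_dotv(1) [OF sub(1) w] sub(3) unfolding ker [OF sub(2)] by simp
      then show "W \<inter> H \<in> B"
        using vec.subspace_inter [OF sub(1) subH] that R by (auto simp: A_def B_def)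
      show "vec.span (insert w (W \<inter> H)) = W"
        using dim_kernel_dotv(2) [OF sub(1) w] unfolding ker [OF sub(2)] .
      show "w \<in> U - H" using sub that by blast
    qed
    then show "\<forall>a\<in>(SIGMA W:A. W - H). (\<lambda>(W, w). (vec.span (insert w W), w)) ((\<lambda>(W, w). (W \<inter> H, w)) a) = a"
      by auto
    show "(\<lambda>(W, w). (W \<inter> H, w)) ` (SIGMA W:A. W - H) \<subseteq> B \<times> (U - H)"
      using 1(2,3) by auto
    have 2: "vec.span (insert w W) \<inter> H = W" "vec.span (insert w W) \<in> A" "w \<in> vec.span (insert w W)"
      if "W \<in> B" "w \<in> U - H" for W w
    proof -
      have w: "w \<in> U" "dotv p w \<noteq> 0" using that H by auto
      have W: "vec.subspace W" "R \<subseteq> W" "W \<subseteq> H" "vec.dim W = d" using that B_def by auto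
      have span: "vec.span W = W" using W(1) by (simp add: vec.span_eq_iff)
      show wW: "w \<in> vec.span (insert w W)" by (simp add: vec.span_base)
      have WW: "W \<subseteq> vec.span (insert w W)" by (auto intro: vec.span_base)
      show "vec.span (insert w W) \<inter> H = W"
      proof
        show "vec.span (insert w W) \<inter> H \<subseteq> W"
        proof
          fix x assume x: "x \<in> vec.span (insert w W) \<inter> H"
          then obtain k where k: "x - k *s w \<in> W"
            using vec.span_breakdown_eq [of x w W] span by auto
          then have "dotv p (x - k *s w) = 0" using W(3) H by auto
          then have "k = 0" using x w H by auto
          then show "x \<in> W" using k by simp
        qed
        show "W \<subseteq> vec.span (insert w W) \<inter> H" using WW W(3) by blast
      qed
      have "vec.dim (vec.span (insert w W)) = Suc d"
        using vec.dim_insert [of w W] span W that by auto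
      moreover have "vec.span (insert w W) \<subseteq> U"
        using w W H by (intro vec.span_minimal U) auto
      ultimately show "vec.span (insert w W) \<in> A"
        using wW WW W that by (auto simp: A_def)
    qed
    show "\<forall>a\<in>B \<times> (U - H). (\<lambda>(W, w). (W \<inter> H, w)) ((\<lambda>(W, w). (vec.span (insert w W), w)) a) = a"
      using 2(1) by auto
    show "(\<lambda>(W, w). (vec.span (insert w W), w)) ` (B \<times> (U - H)) \<subseteq> (SIGMA W:A. W - H)"
      using 2(2,3) by auto
  qed
  then have "card (SIGMA W:A. W - H) = card (B \<times> (U - H))" by (rule bij_betw_same_card)
  moreover have "card (SIGMA W:A. W - H) = (\<Sum>W\<in>A. card (W - H))" by (rule card_SigmaI) auto
  moreover have "\<dots> = (\<Sum>W\<in>A. (?q - 1) * ?q ^ d)" by (rule sum.cong) (simp_all add: A_def complement)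
  moreover have "card (U - H) = (?q - 1) * ?q ^ vec.dim H"
    using complement [OF U order_refl _ dimU] u H by auto
  ultimately have "(?q - 1) * (card A * ?q ^ d) = (?q - 1) * (?q ^ vec.dim H * card B)"
    by (simp add: card_cartesian_product mult_ac)
  then show ?thesis using q by (simp add: A_def B_def)
qed

text \<open>Induct on the codimension of \<open>R\<close> in \<open>U\<close>, using a hyperplane
  \<open>H\<close> of \<open>U\<close> that contains \<open>R\<close>. Subspaces inside
  \<open>H\<close> are counted by the induction hypothesis, the others by
  \<open>card_subspaces_between_aux\<close>, and the counts add up by
  \<open>qbinom_Suc_Suc'\<close>.\<close>

lemma card_subspaces_between:
  fixes R U :: "('f::{finite,field}^'n) set"
  assumes "vec.subspace R" "vec.subspace U" "R \<subseteq> U"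
  shows "card {W. vec.subspace W \<and> R \<subseteq> W \<and> W \<subseteq> U \<and> vec.dim W = vec.dim R + j}
    = qbinom CARD('f) (vec.dim U - vec.dim R) j"
  using assms
proof (induction "vec.dim U - vec.dim R" arbitrary: U j)
  case 0
  then have "U = R" using vec.subspace_dim_equal [of R U] by simp
  then have "{W. vec.subspace W \<and> R \<subseteq> W \<and> W \<subseteq> U \<and> vec.dim W = vec.dim R + j} = (if j = 0 then {R} else {})"
    using 0 by auto
  then show ?case using \<open>U = R\<close> by (cases j) auto
next
  case (Suc a)
  note R = Suc.prems(1) and U = Suc.prems(2)
  have a: "vec.dim U - vec.dim R = Suc a" using Suc.hyps(2) by simp
  show ?case
  proof (cases j)
    case 0
    have "W = R" if "vec.subspace W" "R \<subseteq> W" "vec.dim W = vec.dim R" for W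
      using vec.subspace_dim_equal [OF R that(1,2)] that(3) by simp
    then have "{W. vec.subspace W \<and> R \<subseteq> W \<and> W \<subseteq> U \<and> vec.dim W = vec.dim R + j} = {R}"
      using Suc.prems 0 by auto
    then show ?thesis using 0 by simp
  next
    case j: (Suc b)
    have "\<not> U \<subseteq> R" using a vec.dim_subset [of U R] by auto
    then obtain u where u: "u \<in> U" "u \<notin> R" by blast
    obtain p where p: "dotv p u = 1" "\<And>x. x \<in> R \<Longrightarrow> dotv p x = 0"
      using exists_separating_functional [OF R u(2)] by metis
    define H where "H = {x \<in> U. dotv p x = 0}"
    have H: "vec.subspace H" unfolding H_def by (rule subspace_kernel_dotv [OF U])
    have RH: "R \<subseteq> H" and HU: "H \<subseteq> U" using p(2) Suc.prems(3) H_def by auto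
    have "vec.dim U = Suc (vec.dim H)" using dim_kernel_dotv(1) [OF U u(1), of p] p(1) H_def by simp
    then have dimH: "vec.dim H - vec.dim R = a" "vec.dim H = vec.dim R + a" using a by auto
    let ?S = "\<lambda>P d. {W. vec.subspace W \<and> R \<subseteq> W \<and> P W \<and> vec.dim W = d}"
    let ?A = "{W. vec.subspace W \<and> R \<subseteq> W \<and> W \<subseteq> U \<and> vec.dim W = Suc (vec.dim R + b) \<and> \<not> W \<subseteq> H}"
    have IH: "card {W. vec.subspace W \<and> R \<subseteq> W \<and> W \<subseteq> H \<and> vec.dim W = vec.dim R + i} = qbinom CARD('f) a i" for i
      using Suc.hyps(1) [of H i] dimH R H RH by simp
    have "card ?A * CARD('f) ^ (vec.dim R + b) = CARD('f) ^ (vec.dim R + a) * qbinom CARD('f) a b"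
      using card_subspaces_between_aux [OF U H_def RH u(1), of "vec.dim R + b"] p(1) IH [of b] dimH(2) by simp
    \<comment> \<open>For \<open>b > a\<close> the exponent \<open>a - b\<close> is truncated to 0,
      but both sides vanish together with \<open>qbinom\<close>.\<close>
    then have A: "card ?A = CARD('f) ^ (a - b) * qbinom CARD('f) a b"
    proof (cases "b \<le> a")
      case True
      then obtain c where "a = b + c" using le_Suc_ex by blast
      then show ?thesis
        using \<open>card ?A * _ = _\<close> by (simp add: power_add mult_ac)
    qed (simp add: qbinom_eq_0)
    let ?B = "{W. vec.subspace W \<and> R \<subseteq> W \<and> W \<subseteq> H \<and> vec.dim W = vec.dim R + Suc b}"
    have split: "{W. vec.subspace W \<and> R \<subseteq> W \<and> W \<subseteq> U \<and> vec.dim W = vec.dim R + j} = ?A \<union> ?B"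
      using HU by (auto simp: j)
    have "card (?A \<union> ?B) = card ?A + card ?B" by (rule card_Un_disjoint) auto
    also have "\<dots> = CARD('f) ^ (a - b) * qbinom CARD('f) a b + qbinom CARD('f) a (Suc b)"
      by (simp only: A IH)
    also have "\<dots> = qbinom CARD('f) (Suc a) (Suc b)"
      using qbinom_Suc_Suc' [of b a "CARD('f)"] by (cases "b \<le> a") (simp_all add: qbinom_eq_0 del: qbinom.simps)
    finally show ?thesis unfolding split a unfolding j .
  qed
qed

text \<open>The square of \<open>mu q d\<close> is \<open>q^(d(d-1))\<close>, and
  \<open>(n-1)d = d(n-d) + d(d-1)\<close>. This brings the constant of \<open>eta_W\<close> into the
  shape of the one in \<open>eta_r\<close>.\<close>

lemma inverse_mu_eq:
  fixes Q :: "'k::field"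
  assumes "Q = of_nat q" "Q \<noteq> 0" "d \<le> n"
  shows "inverse (Q ^ (d * (n - d))) * inverse (mu q d) = inverse (Q ^ ((n - 1) * d)) * mu q d"
proof -
  obtain e where n: "n = d + e" using assms(3) le_Suc_ex by blast
  have "d * (d - 1) = 2 * (d choose 2)" by (cases d) (simp_all add: choose_two)
  moreover have "(n - 1) * d = d * (n - d) + d * (d - 1)"
    by (cases d) (simp_all add: n algebra_simps)
  ultimately have exp: "(n - 1) * d = d * (n - d) + ((d choose 2) + (d choose 2))" by simp
  have "(-1 :: 'k) ^ d * (-1) ^ d = 1" by (simp flip: power_add)
  then have "mu q d * mu q d = Q ^ ((d choose 2) + (d choose 2))"
    by (simp add: mu_def assms(1) power_add mult_ac)
  moreover have "mu q d \<noteq> (0 :: 'k)" using assms by (simp add: mu_def)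
  ultimately show ?thesis using assms(2) unfolding exp power_add [of Q "d * (n - d)"]
    by (simp add: field_simps)
qed

text \<open>Here \<open>\<rho>\<close> stands for the rank of a matrix and \<open>d\<close> for the
  dimension of a subspace containing its image. Raising \<open>r\<close> adds one term, part of
  which cancels the previous closed form.\<close>

lemma sum_qbinom_mu:
  fixes Q :: "'k::field"
  assumes Q: "Q = of_nat q" "Q \<noteq> 0" and "\<rho> \<le> r" "r < n"
  shows "(\<Sum>d=\<rho>..r. of_nat (qbinom q (n - \<rho>) (d - \<rho>)) * (inverse (Q ^ ((n - 1) * d)) * mu q d))
    = inverse (Q ^ ((n - 1) * r)) * mu q r * of_nat (qbinom q (n - 1 - \<rho>) (r - \<rho>))"
  using assms(3,4)
proof (induction r rule: dec_induct)
  case base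
  then show ?case by simp
next
  case (step r)
  obtain b where r: "r = \<rho> + b" using step.hyps(1) le_Suc_ex by blast
  obtain c where n: "n = Suc (Suc (r + c))"
    using step.prems by (metis less_iff_Suc_add add_Suc)
  let ?\<delta> = "\<lambda>d. inverse (Q ^ ((n - 1) * d)) * mu q d"
  \<comment> \<open>\<open>Suc c\<close> is \<open>n - 1 - r\<close>, the very power of
    \<open>q\<close> in \<open>pascal\<close> below, so the first Pascal term cancels the previous
    partial sum.\<close>
  have \<delta>: "?\<delta> r = - (Q ^ Suc c * ?\<delta> (Suc r))"
  proof -
    have "Q ^ ((n - 1) * Suc r) = Q ^ ((n - 1) * r) * (Q ^ Suc c * Q ^ r)"
      by (simp add: n power_add [symmetric] algebra_simps)
    then show ?thesis using Q by (simp add: mu_Suc field_simps)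
  qed
  have pascal: "qbinom q (n - \<rho>) (Suc r - \<rho>) = q ^ Suc c * qbinom q (n - 1 - \<rho>) (r - \<rho>) + qbinom q (n - 1 - \<rho>) (Suc r - \<rho>)"
    using qbinom_Suc_Suc' [of b "Suc (b + c)" q] by (simp add: n r del: qbinom.simps)
  have "(\<Sum>d=\<rho>..Suc r. of_nat (qbinom q (n - \<rho>) (d - \<rho>)) * ?\<delta> d)
      = ?\<delta> r * of_nat (qbinom q (n - 1 - \<rho>) (r - \<rho>)) + of_nat (qbinom q (n - \<rho>) (Suc r - \<rho>)) * ?\<delta> (Suc r)"
    using step.IH step.prems step.hyps(1) by (simp add: sum.nat_ivl_Suc')
  also have "\<dots> = ?\<delta> (Suc r) * of_nat (qbinom q (n - 1 - \<rho>) (Suc r - \<rho>))"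
    unfolding \<delta> pascal by (simp add: Q(1) algebra_simps)
  finally show ?case .
qed

subsection \<open>The elements \<open>\<eta>\<^sub>W\<close>\<close>

lemma matrix_add_outer_mult_vec:
  "dotv p x = 0 \<Longrightarrow> (T + outer w p) *v x = T *v x"
  by (simp add: matrix_vector_mult_add_rdistrib)

lemma range_add_outer:
  assumes "vec.subspace W" "w \<in> W" "range ((*v) T) \<subseteq> W"
  shows "range ((*v) (T + outer w p)) \<subseteq> W"
  using assms
  by (auto simp: matrix_vector_mult_add_rdistrib image_subset_iff intro: vec.subspace_add vec.subspace_scale)

text \<open>Each shift by \<open>g i\<close> injects the finite set \<open>A\<close> into itself,
  hence permutes it, so \<open>card I\<close> times \<open>sum f A\<close> is the sum over all
  shifts, which vanishes after exchanging the sums. In the applications \<open>card I\<close> is a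
  power of \<open>q\<close>, invertible in the coefficient field.\<close>

lemma sum_eq_0_averaging:
  fixes f :: "'m::ab_group_add \<Rightarrow> 'k::field"
  assumes "finite A" "of_nat (card I) \<noteq> (0 :: 'k)"
    and closed: "\<And>T i. T \<in> A \<Longrightarrow> i \<in> I \<Longrightarrow> T + g i \<in> A"
    and zero: "\<And>T. T \<in> A \<Longrightarrow> (\<Sum>i\<in>I. f (T + g i)) = 0"
  shows "sum f A = 0"
proof -
  have "sum f A = (\<Sum>T\<in>A. f (T + g i))" if "i \<in> I" for i
  proof -
    have "inj_on (\<lambda>T. T + g i) A" by (rule inj_onI) simp
    moreover have "(\<lambda>T. T + g i) ` A = A"
      by (rule endo_inj_surj [OF assms(1)]) (use calculation closed that in auto)
    ultimately show ?thesis by (metis sum.reindex_cong)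
  qed
  then have "(\<Sum>i\<in>I. sum f A) = (\<Sum>i\<in>I. \<Sum>T\<in>A. f (T + g i))" by (rule sum.cong [OF refl])
  then have "of_nat (card I) * sum f A = (\<Sum>i\<in>I. \<Sum>T\<in>A. f (T + g i))" by simp
  also have "\<dots> = (\<Sum>T\<in>A. \<Sum>i\<in>I. f (T + g i))" by (rule sum.swap)
  also have "\<dots> = 0" using zero by simp
  finally show ?thesis using assms(2) by simp
qed

lemma of_nat_card_subspace_neq_0:
  fixes W :: "('f::{finite,field}^'n) set"
  assumes "of_nat CARD('f) \<noteq> (0 :: 'k::field)" "vec.subspace W"
  shows "of_nat (card W) \<noteq> (0 :: 'k)"
  using assms by (simp add: card_subspace)

text \<open>Pick \<open>u\<close> in \<open>W\<close> outside \<open>U\<close> and a functional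
  \<open>p\<close> vanishing on \<open>U\<close> with value 1 at \<open>u\<close>. Adding
  \<open>outer w p\<close> for \<open>w\<close> in \<open>W\<close> preserves both the restriction
  to \<open>U\<close> and the image condition, so averaging reduces to
  \<open>sum_chi_coset\<close>.\<close>

lemma sum_chi_closed_under_restriction:
  fixes W U :: "('f::{finite,field}^'n) set" and S :: "('f^'n^'n) set"
  assumes q: "of_nat CARD('f) \<noteq> (0 :: 'k::field)" and W: "vec.subspace W" and U: "vec.subspace U"
    and "\<not> W \<subseteq> U"
    and S: "\<And>T T'. T \<in> S \<Longrightarrow> (\<And>x. x \<in> U \<Longrightarrow> T' *v x = T *v x) \<Longrightarrow> T' \<in> S"
  shows "(\<Sum>T\<in>{T \<in> S. range ((*v) T) \<subseteq> W}. chi T) = (0 :: 'k)"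
proof -
  obtain u where u: "u \<in> W" "u \<notin> U" using assms(4) by blast
  obtain p where p: "dotv p u = 1" "\<And>x. x \<in> U \<Longrightarrow> dotv p x = 0"
    using exists_separating_functional [OF U u(2)] by metis
  show ?thesis
  proof (rule sum_eq_0_averaging [where I = W and g = "\<lambda>w. outer w p"])
    show "of_nat (card W) \<noteq> (0 :: 'k)" by (rule of_nat_card_subspace_neq_0 [OF q W])
    show "T + outer w p \<in> {T \<in> S. range ((*v) T) \<subseteq> W}"
      if "T \<in> {T \<in> S. range ((*v) T) \<subseteq> W}" "w \<in> W" for T w
      using that S [of T "T + outer w p"] range_add_outer [OF W, of w T p]
      by (simp add: matrix_add_outer_mult_vec p(2))
    show "(\<Sum>w\<in>W. chi (T + outer w p)) = (0 :: 'k)" if "T \<in> {T \<in> S. range ((*v) T) \<subseteq> W}" for T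
      using that u(1) p(1) by (intro sum_chi_coset [OF W]) auto
  qed simp
qed

text \<open>Transposing turns the shifts by \<open>outer v p\<close> into a coset with
  \<open>v\<close> as its functional, and \<open>sum_chi_coset\<close> applies with the full space
  in place of \<open>W\<close>. Conditions on images are carried by \<open>S\<close>.\<close>

lemma sum_chi_closed_under_outer:
  fixes v :: "'f::{finite,field}^'n" and S :: "('f^'n^'n) set"
  assumes q: "of_nat CARD('f) \<noteq> (0 :: 'k::field)" and v: "v \<noteq> 0"
    and S: "\<And>T p. T \<in> S \<Longrightarrow> T + outer v p \<in> S"
  shows "(\<Sum>T\<in>S. chi T) = (0 :: 'k)"
proof (rule sum_eq_0_averaging [where I = UNIV and g = "outer v"])
  show "of_nat (card (UNIV :: ('f^'n) set)) \<noteq> (0 :: 'k)"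
    by (rule of_nat_card_subspace_neq_0 [OF q vec.subspace_UNIV])
  obtain i where "v $ i \<noteq> 0" using v by (auto simp: vec_eq_iff)
  then have i: "dotv v (axis i 1) \<noteq> 0"
    unfolding dotv_def axis_def by (simp add: if_distrib [of "\<lambda>y. _ * y"] cong: if_cong)
  show "(\<Sum>p\<in>UNIV. chi (T + outer v p)) = (0 :: 'k)" for T
  proof -
    have "chi (T + outer v p) = (chi (transpose T + outer p v) :: 'k)" for p
      unfolding transpose_outer [of v p, symmetric] transpose_add [symmetric] by (rule chi_transpose [symmetric])
    then show ?thesis
      using sum_chi_coset [OF vec.subspace_UNIV _ _ i, of "transpose T"] by simp
  qed
qed (use S in auto)

text \<open>For a subspace \<open>W\<close>, the inverse of the number of projections onto
  \<open>W\<close> times their common weight.\<close>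

definition coeff_W :: "('f::{finite,field}^'n) set \<Rightarrow> 'k::field" where
  "coeff_W W = inverse (of_nat CARD('f) ^ (vec.dim W * (CARD('n) - vec.dim W)))
    * inverse (mu CARD('f) (vec.dim W))"

lemma eta_W_eq:
  fixes T :: "'f::{finite,field}^'n^'n"
  shows "eta_W W T = (if range ((*v) T) \<subseteq> W then coeff_W W * chi T else 0)"
  by (simp add: eta_W_def coeff_W_def chi_def)

lemma sum_eta_W:
  fixes W :: "('f::{finite,field}^'n) set"
  shows "(\<Sum>T\<in>S. eta_W W T) = coeff_W W * (\<Sum>T\<in>{T \<in> S. range ((*v) T) \<subseteq> W}. chi T)"
  by (simp add: eta_W_eq sum.inter_filter sum_distrib_left if_distrib cong: if_cong)

lemma sum_coeff_projections:
  fixes W :: "('f::{finite,field}^'n) set"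
  assumes q: "of_nat CARD('f) \<noteq> (0 :: 'k::field)" and "vec.subspace W"
  shows "(\<Sum>T\<in>{T :: 'f^'n^'n. range ((*v) T) \<subseteq> W \<and> (\<forall>x\<in>W. T *v x = x)}.
    coeff_W W * mu CARD('f) (vec.dim W)) = (1 :: 'k)"
proof -
  have "mu CARD('f) (vec.dim W) \<noteq> (0 :: 'k)" using q by (simp add: mu_def)
  then show ?thesis using q by (simp add: card_projections [OF assms(2)] coeff_W_def field_simps)
qed

lemma chi_injective_on:
  fixes T :: "'f::{finite,field}^'n^'n"
  assumes W: "vec.subspace W" and T: "range ((*v) T) \<subseteq> W"
    and inj: "\<And>v. v \<in> W \<Longrightarrow> T *v v = 0 \<Longrightarrow> v = 0"
  shows "chi T = (if \<forall>x\<in>W. T *v x = x then mu CARD('f) (vec.dim W) else 0 :: 'k::field)"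
proof (cases "\<forall>x\<in>W. T *v x = x")
  case True
  then show ?thesis using chi_projection [OF T] by simp
next
  case False
  then obtain x where "x \<in> W" "T *v x \<noteq> x" by blast
  then have "chi T = (0 :: 'k)" using chi_eq_0 [OF W _ inj] T by blast
  then show ?thesis by (simp only: False if_False)
qed

section \<open>Orthogonality and idempotence in the monoid algebra\<close>

lemma alg_mult_eq_sum_left:
  fixes m :: "'f::{finite,field}^'n^'n"
  shows "alg_mult a b m = (\<Sum>T1\<in>UNIV. a T1 * (\<Sum>T2\<in>{T2. T1 ** T2 = m}. b T2))"
proof -
  have "{(T1, T2 :: 'f^'n^'n). T1 ** T2 = m} = (SIGMA T1:UNIV. {T2. T1 ** T2 = m})" by auto
  then have "alg_mult a b m = (\<Sum>(T1, T2)\<in>(SIGMA T1:UNIV. {T2. T1 ** T2 = m}). a T1 * b T2)"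
    unfolding alg_mult_def by (simp add: case_prod_unfold)
  also have "\<dots> = (\<Sum>T1\<in>UNIV. \<Sum>T2\<in>{T2. T1 ** T2 = m}. a T1 * b T2)"
    by (rule sum.Sigma [symmetric]) auto
  finally show ?thesis by (simp add: sum_distrib_left)
qed

lemma alg_mult_eq_sum_right: "alg_mult a b m = (\<Sum>T2\<in>UNIV. (\<Sum>T1\<in>{T1. T1 ** T2 = m}. a T1) * b T2)"
proof -
  have "alg_mult a b m = (\<Sum>T1\<in>UNIV. \<Sum>T2\<in>UNIV. if T1 ** T2 = m then a T1 * b T2 else 0)"
    by (simp add: alg_mult_eq_sum_left sum_distrib_left sum.inter_filter [symmetric])
  also have "\<dots> = (\<Sum>T2\<in>UNIV. \<Sum>T1\<in>UNIV. if T1 ** T2 = m then a T1 * b T2 else 0)"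
    by (rule sum.swap)
  finally show ?thesis by (simp add: sum_distrib_right sum.inter_filter [symmetric])
qed

text \<open>As \<open>T\<close> kills \<open>v\<close>, adding \<open>outer v p\<close> to
  \<open>T'\<close> changes neither \<open>T ** T'\<close> nor the inclusion of the image in
  \<open>W\<close>.\<close>

lemma sum_eta_W_left_mult_eq_0:
  fixes W :: "('f::{finite,field}^'n) set" and T :: "'f^'n^'n"
  assumes "of_nat CARD('f) \<noteq> (0 :: 'k::field)" "vec.subspace W" "v \<in> W" "v \<noteq> 0" "T *v v = 0"
  shows "(\<Sum>T'\<in>{T'. T ** T' = m}. eta_W W T') = (0 :: 'k)"
proof -
  have "(\<Sum>T'\<in>{T' \<in> {T'. T ** T' = m}. range ((*v) T') \<subseteq> W}. chi T') = (0 :: 'k)"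
  proof (rule sum_chi_closed_under_outer [OF assms(1,4)])
    fix T' :: "'f^'n^'n" and p :: "'f^'n" assume "T' \<in> {T' \<in> {T'. T ** T' = m}. range ((*v) T') \<subseteq> W}"
    moreover have "outer 0 p = 0" by (simp add: outer_def vec_eq_iff)
    ultimately show "T' + outer v p \<in> {T' \<in> {T'. T ** T' = m}. range ((*v) T') \<subseteq> W}"
      using range_add_outer [OF assms(2,3)] by (simp add: matrix_add_ldistrib matrix_mult_outer assms(5))
  qed
  then show ?thesis by (simp add: sum_eta_W)
qed

text \<open>If \<open>W1 \<subseteq> W2\<close>, the dimension drops, so a left factor with image in
  \<open>W1\<close> kills a nonzero vector of \<open>W2\<close> and the sum over right factors
  vanishes. Otherwise, for a right factor with image in \<open>W2\<close>, the product sees the left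
  factor only through its restriction to \<open>W2\<close>, and the sum over left factors
  vanishes.\<close>

lemma eta_W_mult_eq_0:
  fixes W1 W2 :: "('f::{finite,field}^'n) set"
  assumes q: "of_nat CARD('f) \<noteq> (0 :: 'k::field)" and W1: "vec.subspace W1" and W2: "vec.subspace W2"
    and "W1 \<noteq> W2"
  shows "alg_mult (eta_W W1) (eta_W W2) m = (0 :: 'k)"
proof (cases "W1 \<subseteq> W2")
  case True
  then have less: "vec.dim W1 < vec.dim W2"
    using vec.subspace_dim_equal [OF W1 W2] assms(4) by (metis not_less)
  have "eta_W W1 T1 * (\<Sum>T2\<in>{T2. T1 ** T2 = m}. eta_W W2 T2) = (0 :: 'k)" for T1
  proof (cases "range ((*v) T1) \<subseteq> W1")
    case True
    then have "vec.dim ((*v) T1 ` W2) \<le> vec.dim W1" by (intro vec.dim_subset) auto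
    then obtain v where v: "v \<in> W2" "v \<noteq> 0" "T1 *v v = 0"
      using dim_image_eq_of_trivial_kernel [OF W2, of T1] less by (metis leD)
    show ?thesis by (simp add: sum_eta_W_left_mult_eq_0 [OF q W2 v])
  qed (simp add: eta_W_eq)
  then show ?thesis unfolding alg_mult_eq_sum_left by (intro sum.neutral ballI)
next
  case False
  have "(\<Sum>T1\<in>{T1. T1 ** T2 = m}. eta_W W1 T1) * eta_W W2 T2 = (0 :: 'k)" for T2
  proof (cases "range ((*v) T2) \<subseteq> W2")
    case True
    have "(\<Sum>T1\<in>{T1 \<in> {T1. T1 ** T2 = m}. range ((*v) T1) \<subseteq> W1}. chi T1) = (0 :: 'k)"
    proof (rule sum_chi_closed_under_restriction [OF q W1 W2 False])
      fix T T' assume "T \<in> {T1. T1 ** T2 = m}" "\<And>x. x \<in> W2 \<Longrightarrow> T' *v x = T *v x"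
      then show "T' \<in> {T1. T1 ** T2 = m}"
        using True by (auto simp: matrix_eq matrix_vector_mul_assoc [symmetric] image_subset_iff)
    qed
    then show ?thesis by (simp add: sum_eta_W)
  qed (simp add: eta_W_eq)
  then show ?thesis unfolding alg_mult_eq_sum_right by (intro sum.neutral ballI)
qed

text \<open>Sort the left factors with image in \<open>W\<close> by their action on
  \<open>W\<close>: a kernel there makes the inner sum vanish, an injective action other than the
  identity has weight zero, and a projection acts as a left identity on the support of
  \<open>eta_W W\<close>. The projections have total coefficient 1.\<close>

lemma eta_W_idempotent:
  fixes W :: "('f::{finite,field}^'n) set"
  assumes q: "of_nat CARD('f) \<noteq> (0 :: 'k::field)" and W: "vec.subspace W"
  shows "alg_mult (eta_W W) (eta_W W) m = (eta_W W m :: 'k)"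
proof -
  let ?P = "{T :: 'f^'n^'n. range ((*v) T) \<subseteq> W \<and> (\<forall>x\<in>W. T *v x = x)}"
  have summand: "eta_W W T * (\<Sum>T'\<in>{T'. T ** T' = m}. eta_W W T')
      = (if T \<in> ?P then coeff_W W * mu CARD('f) (vec.dim W) * eta_W W m else 0 :: 'k)" for T
  proof (cases "range ((*v) T) \<subseteq> W")
    case T: True
    show ?thesis
    proof (cases "\<exists>v\<in>W. v \<noteq> 0 \<and> T *v v = 0")
      case True
      then obtain v where v: "v \<in> W" "v \<noteq> 0" "T *v v = 0" by blast
      then have "T *v v \<noteq> v" by auto
      with v have "T \<notin> ?P" by blast
      then show ?thesis
        by (simp only: sum_eta_W_left_mult_eq_0 [OF q W v] mult_zero_right if_False)
    next
      case False
      then have chi: "chi T = (if \<forall>x\<in>W. T *v x = x then mu CARD('f) (vec.dim W) else 0 :: 'k)"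
        by (intro chi_injective_on [OF W T]) blast
      show ?thesis
      proof (cases "T \<in> ?P")
        case True
        have fix_W: "T ** T' = T'" if "range ((*v) T') \<subseteq> W" for T'
          using True that by (auto simp: matrix_eq matrix_vector_mul_assoc [symmetric] image_subset_iff)
        have "(\<Sum>T'\<in>{T'. T ** T' = m}. eta_W W T') = (\<Sum>T'\<in>UNIV. if T' = m then eta_W W m else 0 :: 'k)"
        proof (rule sum.mono_neutral_cong_left)
          have "eta_W W T' = (0 :: 'k)" if "T ** T' \<noteq> T'" for T'
            using fix_W that by (auto simp: eta_W_eq)
          \<comment> \<open>If the image of \<open>m\<close> is not inside \<open>W\<close>,
            \<open>m\<close> may be missing from the index set, but then its coefficient is
            zero.\<close>
          moreover have "T ** m = m \<or> eta_W W m = (0 :: 'k)"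
            using fix_W by (auto simp: eta_W_eq)
          ultimately show "\<forall>i\<in>UNIV - {T'. T ** T' = m}. (if i = m then eta_W W m else 0) = (0 :: 'k)"
            and "\<And>x. x \<in> {T'. T ** T' = m} \<Longrightarrow> eta_W W x = (if x = m then eta_W W m else 0 :: 'k)"
            by auto
        qed auto
        then show ?thesis using True chi by (simp add: eta_W_eq [of W T])
      qed (use T chi in \<open>auto simp: eta_W_eq\<close>)
    qed
  qed (auto simp: eta_W_eq)
  have "alg_mult (eta_W W) (eta_W W) m
      = (\<Sum>T\<in>?P. coeff_W W * mu CARD('f) (vec.dim W) * eta_W W m :: 'k)"
    by (simp add: alg_mult_eq_sum_left summand sum.inter_filter [symmetric])
  also have "\<dots> = (\<Sum>T\<in>?P. coeff_W W * mu CARD('f) (vec.dim W)) * eta_W W m"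
    by (rule sum_distrib_right [symmetric])
  also have "\<dots> = eta_W W m" by (simp only: sum_coeff_projections [OF q W] mult_1)
  finally show ?thesis .
qed

section \<open>Images in the groupoid algebra\<close>

lemma range_subset_dim_image:
  fixes T :: "'f::field^'n^'n"
  shows "range ((*v) T) \<subseteq> W \<Longrightarrow> vec.dim ((*v) T ` U) \<le> vec.dim W"
  by (intro vec.dim_subset) auto

lemma psi_eta_W_eq_0:
  fixes W :: "('f::{finite,field}^'n) set"
  assumes "vec.dim W < r"
  shows "psi r (eta_W W) g = (0 :: 'k::field)"
  unfolding psi_def
proof (intro sum.neutral ballI)
  fix m :: "'f^'n^'n"
  show "eta_W W m * (\<Sum>U | vec.subspace U \<and> vec.dim U = r \<and> vec.dim ((*v) m ` U) = r. mbasis (restr_mor m U) g) = (0 :: 'k)"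
  proof (cases "range ((*v) m) \<subseteq> W")
    case True
    then have "vec.dim ((*v) m ` U) \<noteq> r" for U
      using range_subset_dim_image [OF True, of U] assms by simp
    then show ?thesis by simp
  qed (simp add: eta_W_eq)
qed

text \<open>Fix \<open>U\<close> and sum over \<open>m\<close> first. The morphism depends only on
  \<open>m\<close> restricted to \<open>U\<close>, and a different \<open>U\<close> of the same
  dimension cannot contain \<open>W\<close>, so its contribution vanishes. For \<open>U = W\<close>
  the dimension condition forces injectivity on \<open>W\<close>, and only projections survive, each
  restricting to the identity.\<close>

lemma psi_eta_W:
  fixes W :: "('f::{finite,field}^'n) set"
  assumes q: "of_nat CARD('f) \<noteq> (0 :: 'k::field)" and W: "vec.subspace W"
  shows "psi (vec.dim W) (eta_W W) g = (mbasis (id_mor W) g :: 'k)"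
proof -
  let ?r = "vec.dim W"
  let ?\<U> = "{U :: ('f^'n) set. vec.subspace U \<and> vec.dim U = ?r}"
  let ?S = "\<lambda>U. {m :: 'f^'n^'n. vec.dim ((*v) m ` U) = ?r \<and> g = restr_mor m U}"
  let ?P = "{T :: 'f^'n^'n. range ((*v) T) \<subseteq> W \<and> (\<forall>x\<in>W. T *v x = x)}"
  have "psi ?r (eta_W W) g = (\<Sum>m\<in>UNIV. \<Sum>U\<in>?\<U>. if m \<in> ?S U then eta_W W m else 0 :: 'k)"
    unfolding psi_def
  proof (rule sum.cong [OF refl])
    fix m :: "'f^'n^'n"
    have "{U. vec.subspace U \<and> vec.dim U = ?r \<and> vec.dim ((*v) m ` U) = ?r}
        = {U \<in> ?\<U>. vec.dim ((*v) m ` U) = ?r}" by auto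
    then show "eta_W W m * (\<Sum>U | vec.subspace U \<and> vec.dim U = ?r \<and> vec.dim ((*v) m ` U) = ?r. mbasis (restr_mor m U) g)
        = (\<Sum>U\<in>?\<U>. if m \<in> ?S U then eta_W W m else 0 :: 'k)"
      by (simp only: sum.inter_filter [OF finite] sum_distrib_left)
        (rule sum.cong, auto simp: mbasis_def)
  qed
  also have "\<dots> = (\<Sum>U\<in>?\<U>. \<Sum>m\<in>UNIV. if m \<in> ?S U then eta_W W m else 0)" by (rule sum.swap)
  also have "\<dots> = (\<Sum>U\<in>?\<U>. \<Sum>m\<in>?S U. eta_W W m)"
    by (simp add: sum.inter_filter [symmetric])
  also have "\<dots> = (\<Sum>U\<in>?\<U>. if U = W then mbasis (id_mor W) g else 0)"
  proof (rule sum.cong [OF refl])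
    fix U :: "('f^'n) set" assume "U \<in> ?\<U>"
    then have U: "vec.subspace U" "vec.dim U = ?r" by auto
    show "(\<Sum>m\<in>?S U. eta_W W m) = (if U = W then mbasis (id_mor W) g else 0 :: 'k)"
    proof (cases "U = W")
      case False
      then have "\<not> W \<subseteq> U" using vec.subspace_dim_equal [OF W U(1)] U(2) by auto
      have "(\<Sum>m\<in>{m \<in> ?S U. range ((*v) m) \<subseteq> W}. chi m) = (0 :: 'k)"
      proof (rule sum_chi_closed_under_restriction [OF q W U(1) \<open>\<not> W \<subseteq> U\<close>])
        fix T T' :: "'f^'n^'n" assume T: "T \<in> ?S U" and eq: "\<And>x. x \<in> U \<Longrightarrow> T' *v x = T *v x"
        have "(*v) T' ` U = (*v) T ` U" using eq by simp
        moreover have "restr_mor T' U = restr_mor T U"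
          unfolding restr_mor_def using eq calculation by (auto simp: fun_eq_iff)
        ultimately show "T' \<in> ?S U" using T by simp
      qed
      then show ?thesis using False by (simp add: sum_eta_W)
    next
      case True
      have "eta_W W m = (if m \<in> ?P then coeff_W W * mu CARD('f) ?r else 0 :: 'k)" if "m \<in> ?S W" for m
      proof (cases "range ((*v) m) \<subseteq> W")
        case m: True
        have inj: "inj_on ((*v) m) W"
        proof (rule eq_card_imp_inj_on)
          have "vec.subspace ((*v) m ` W)" by (rule vec.linear_subspace_image [OF _ W]) simp
          then show "card ((*v) m ` W) = card W"
            using that W by (simp add: card_subspace)
        qed simp
        have "v = 0" if "v \<in> W" "m *v v = 0" for v
          using inj_onD [OF inj, of v 0] that vec.subspace_0 [OF W] by simp
        then have "chi m = (if \<forall>x\<in>W. m *v x = x then mu CARD('f) ?r else 0 :: 'k)"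
          by (rule chi_injective_on [OF W m])
        then show ?thesis using m by (simp add: eta_W_eq)
      qed (simp add: eta_W_eq)
      then have "(\<Sum>m\<in>?S W. eta_W W m) = (\<Sum>m\<in>?S W. if m \<in> ?P then coeff_W W * mu CARD('f) ?r else 0 :: 'k)"
        by (rule sum.cong [OF refl])
      also have "\<dots> = (\<Sum>m\<in>?S W \<inter> ?P. coeff_W W * mu CARD('f) ?r)"
        by (rule sum.inter_restrict [symmetric]) simp
      also have "\<dots> = mbasis (id_mor W) g"
      proof -
        have "restr_mor m W = id_mor W" "(*v) m ` W = W" if "m \<in> ?P" for m
        proof -
          show "(*v) m ` W = W" using that by auto
          then show "restr_mor m W = id_mor W" using that by (auto simp: restr_mor_def id_mor_def)
        qed
        then have "?S W \<inter> ?P = (if g = id_mor W then ?P else {})" by auto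
        then show ?thesis using sum_coeff_projections [OF q W] by (simp add: mbasis_def)
      qed
      finally show ?thesis using True by simp
    qed
  qed
  also have "\<dots> = mbasis (id_mor W) g" using W by (simp add: sum.delta)
  finally show ?thesis .
qed

text \<open>The coefficient of \<open>m\<close> collects the subspaces containing its image; those
  of dimension \<open>d\<close> number \<open>qbinom q (n - \<rho>) (d - \<rho>)\<close>, which
  leaves \<open>sum_qbinom_mu\<close>.\<close>

lemma eta_r_eq_sum_eta_W:
  fixes m :: "'f::{finite,field}^'n^'n"
  assumes q: "of_nat CARD('f) \<noteq> (0 :: 'k::field)" and r: "r \<le> CARD('n) - 1"
  shows "eta_r r m = (\<Sum>W\<in>{W :: ('f^'n) set. vec.subspace W \<and> vec.dim W \<le> r}. eta_W W m :: 'k)"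
proof -
  let ?R = "range ((*v) m)"
  let ?n = "CARD('n)" and ?\<rho> = "mat_rank m" and ?q = "CARD('f)"
  define Q :: 'k where "Q = of_nat ?q"
  have Q: "Q \<noteq> 0" using q by (simp add: Q_def)
  let ?\<gamma> = "\<lambda>d. inverse (Q ^ ((?n - 1) * d)) * mu ?q d"
  let ?\<W> = "{W :: ('f^'n) set. vec.subspace W \<and> ?R \<subseteq> W \<and> vec.dim W \<le> r}"
  have R: "vec.subspace ?R" by (rule vec.linear_subspace_image) (auto simp: vec.subspace_UNIV)
  have \<rho>: "?\<rho> = vec.dim ?R" by (simp add: mat_rank_def)
  have n: "vec.dim (UNIV :: ('f^'n) set) = ?n" by (rule vec_dim_card)
  have n0: "?n > 0" by simp
  have coeff: "coeff_W W = ?\<gamma> (vec.dim W)" for W :: "('f^'n) set"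
    using inverse_mu_eq [OF Q_def Q, of "vec.dim W" ?n] vec.dim_subset [OF subset_UNIV, of W] n
    by (simp add: coeff_W_def Q_def)
  have "(\<Sum>W\<in>{W. vec.subspace W \<and> vec.dim W \<le> r}. eta_W W m)
      = (\<Sum>W\<in>?\<W>. coeff_W W * chi m :: 'k)"
    by (intro sum.mono_neutral_cong_right) (auto simp: eta_W_eq)
  also have "\<dots> = (\<Sum>W\<in>?\<W>. ?\<gamma> (vec.dim W)) * chi m"
    by (simp add: coeff sum_distrib_right)
  also have "(\<Sum>W\<in>?\<W>. ?\<gamma> (vec.dim W))
      = (\<Sum>d=?\<rho>..r. of_nat (qbinom ?q (?n - ?\<rho>) (d - ?\<rho>)) * ?\<gamma> d)"
  proof -
    have "(\<Sum>W\<in>?\<W>. ?\<gamma> (vec.dim W)) = (\<Sum>d=?\<rho>..r. \<Sum>W\<in>{W \<in> ?\<W>. vec.dim W = d}. ?\<gamma> (vec.dim W))"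
      by (rule sum.group [symmetric]) (auto simp: \<rho> intro: vec.dim_subset)
    also have "\<dots> = (\<Sum>d=?\<rho>..r. of_nat (qbinom ?q (?n - ?\<rho>) (d - ?\<rho>)) * ?\<gamma> d)"
    proof (rule sum.cong [OF refl])
      fix d assume d: "d \<in> {?\<rho>..r}"
      have "{W \<in> ?\<W>. vec.dim W = d}
          = {W. vec.subspace W \<and> ?R \<subseteq> W \<and> W \<subseteq> UNIV \<and> vec.dim W = vec.dim ?R + (d - ?\<rho>)}"
        using d by (auto simp: \<rho>)
      then have "card {W \<in> ?\<W>. vec.dim W = d} = qbinom ?q (?n - ?\<rho>) (d - ?\<rho>)"
        using card_subspaces_between [OF R vec.subspace_UNIV subset_UNIV, of "d - ?\<rho>"] unfolding n \<rho> by simp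
      moreover have "(\<Sum>W\<in>{W \<in> ?\<W>. vec.dim W = d}. ?\<gamma> (vec.dim W)) = (\<Sum>W\<in>{W \<in> ?\<W>. vec.dim W = d}. ?\<gamma> d)"
        by (rule sum.cong) auto
      ultimately show "(\<Sum>W\<in>{W \<in> ?\<W>. vec.dim W = d}. ?\<gamma> (vec.dim W))
          = of_nat (qbinom ?q (?n - ?\<rho>) (d - ?\<rho>)) * ?\<gamma> d"
        by (simp only: sum_constant)
    qed
    finally show ?thesis .
  qed
  \<comment> \<open>When the rank exceeds \<open>r\<close>, the index interval is empty and
    \<open>eta_r\<close> is zero by its own condition.\<close>
  also have "\<dots> * chi m = eta_r r m"
  proof (cases "?\<rho> \<le> r")
    case True
    have "r < ?n" using r n0 by linarith
    show ?thesis
      unfolding sum_qbinom_mu [OF Q_def Q True \<open>r < ?n\<close>]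
      by (simp add: True eta_r_def chi_def Q_def mult_ac)
  qed (simp add: eta_r_def)
  finally show ?thesis by simp
qed

theorem theorem4p2:
  fixes Fty :: "'f::{finite,field} itself" and nty :: "'n::finite itself"
  assumes qnz: "(of_nat CARD('f) :: 'k::field) \<noteq> 0"
  shows
    "(\<forall>W::('f^'n) set. vec.subspace W \<longrightarrow>
        alg_mult (eta_W W) (eta_W W) = (eta_W W :: 'f^'n^'n \<Rightarrow> 'k))
   \<and> (\<forall>W1 W2::('f^'n) set. vec.subspace W1 \<and> vec.subspace W2 \<and> W1 \<noteq> W2 \<longrightarrow>
        alg_mult (eta_W W1) (eta_W W2) = (\<lambda>_. 0 :: 'k))
   \<and> (\<forall>r. r \<le> CARD('n) - 1 \<longrightarrow>
        (eta_r r :: 'f^'n^'n \<Rightarrow> 'k)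
          = (\<lambda>m. \<Sum>W\<in>{W::('f^'n) set. vec.subspace W \<and> vec.dim W \<le> r}. eta_W W m))
   \<and> (\<forall>r (W::('f^'n) set). vec.subspace W \<and> vec.dim W = r \<longrightarrow>
        psi r (eta_W W :: 'f^'n^'n \<Rightarrow> 'k) = mbasis (id_mor W))
   \<and> (\<forall>r (W::('f^'n) set). vec.subspace W \<and> vec.dim W < r \<longrightarrow>
        psi r (eta_W W :: 'f^'n^'n \<Rightarrow> 'k) = (\<lambda>_. 0))"
proof (intro conjI allI impI)
  fix W :: "('f^'n) set"
  assume "vec.subspace W"
  then show "alg_mult (eta_W W) (eta_W W) = (eta_W W :: 'f^'n^'n \<Rightarrow> 'k)"
    by (intro ext eta_W_idempotent [OF qnz])
next
  fix W1 W2 :: "('f^'n) set"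
  assume "vec.subspace W1 \<and> vec.subspace W2 \<and> W1 \<noteq> W2"
  then show "alg_mult (eta_W W1) (eta_W W2) = (\<lambda>_. 0 :: 'k)"
    by (intro ext eta_W_mult_eq_0 [OF qnz]) auto
next
  fix r
  assume "r \<le> CARD('n) - 1"
  then show "(eta_r r :: 'f^'n^'n \<Rightarrow> 'k)
      = (\<lambda>m. \<Sum>W\<in>{W::('f^'n) set. vec.subspace W \<and> vec.dim W \<le> r}. eta_W W m)"
    by (intro ext eta_r_eq_sum_eta_W [OF qnz])
next
  fix r and W :: "('f^'n) set"
  assume "vec.subspace W \<and> vec.dim W = r"
  then show "psi r (eta_W W :: 'f^'n^'n \<Rightarrow> 'k) = mbasis (id_mor W)"
    using psi_eta_W [OF qnz] by (intro ext) auto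
next
  fix r and W :: "('f^'n) set"
  assume "vec.subspace W \<and> vec.dim W < r"
  then show "psi r (eta_W W :: 'f^'n^'n \<Rightarrow> 'k) = (\<lambda>_. 0)"
    by (intro ext psi_eta_W_eq_0) auto
qed

end
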